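(* Let $\mathcal A$ be a poset in which products exist conditionally, let $G$ be a contravariant functor from $\mathcal A$ to abelian groups, and let $\widehat G$ be the induced sheaf on $X^{\mathcal A}$. Then the cochain map $$j^*:C^\bullet(K(\mathcal U^{\mathcal A});G^\vee)\to C^\bullet(N(\mathcal A);G_* ),\qquad (j^*c)(\alpha_0\to\cdots\to\alpha_n)=c(U^{\alpha_0},\dots,U^{\alpha_n})\in\widehat G(U^{\alpha_0})=G(\alpha_0),$$ is a homotopy equivalence of cochain complexes, and thus induces an isomorphism in cohomology.
   Context: Posets are viewed as small categories with at most one arrow between two objects and with $\alpha\to\beta\to\alpha$ implying $\alpha=\beta$. Products exist conditionally: whenever $\alpha,\alpha'$ admit some $\omega$ with $\omega\to\alpha$ and $\omega\to\alpha'$, the categorical product $\alpha\wedge\alpha'$ exists in $\mathcal A$. $X^{\mathcal A}$ is the set of objects of $\mathcal A$ with the upper Alexandrov topology, with basis $U^\beta=\{\alpha\mid\alpha\to\beta\}$; $\widehat G$ is the unique sheaf extending $G$, with $\widehat G(W)=\varprojlim_{\omega\in W}G(\omega)$ for $W$ open and $\widehat G(U^\alpha)=G(\alpha)$. $\mathcal U^{\mathcal A}=\{U^\alpha\}_{\alpha\in\mathcal A}$ is the canonical covering. Čech complex: $C^n(K(\mathcal U^{\mathcal A});G^\vee)=\prod\widehat G(U_0\cap\dots\cap U_n)$, the product being over all sequences $(U_0,\dots,U_n)$ of elements of $\mathcal U^{\mathcal A}$ with non-empty intersection, with differential $(\delta c)(U_0,\dots,U_{n+1})=\sum_{i=0}^{n+1}(-1)^ic(U_0,\dots,\widehat{U_i},\dots,U_{n+1})|_{U_0\cap\dots\cap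 U_{n+1}}$. Nerve complex: $C^n(N(\mathcal A);G_* )=\prod_{\alpha_0\to\cdots\to\alpha_n}G(\alpha_0)$ (over all sequences of arrows in $\mathcal A$, repetitions allowed), with differential $(\delta c)(\alpha_0\to\cdots\to\alpha_{n+1})=G(\alpha_0\to\alpha_1)\,c(\alpha_1\to\cdots\to\alpha_{n+1})+\sum_{i=1}^{n+1}(-1)^ic(\alpha_0\to\cdots\widehat{\alpha_i}\cdots\to\alpha_{n+1})$. Its cohomology is the topos cohomology of $G$, i.e. the derived functors of global sections on presheaves of abelian groups on $\mathcal A$. A cochain map is a homotopy equivalence if it has an inverse up to cochain homotopy. *)

theory Defs
  imports "HOL-Algebra.FiniteProduct" "HOL-Algebra.Product_Groups" "HOL-Analysis.Function_Topology"
begin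

text \<open>Abelian groups are written multiplicatively, as \<^const>\<open>comm_group\<close>
  structures; thus \<open>(-1)\<^sup>i x\<close> appears as \<open>x [^] (-1)^i\<close> and sums appear as \<^const>\<open>finprod\<close>.\<close>

section \<open>Cochain complexes of abelian groups\<close>

record 'g cochains =
  grp :: "nat \<Rightarrow> 'g monoid"
  diff :: "nat \<Rightarrow> 'g \<Rightarrow> 'g"

definition cochain_complex :: "'g cochains \<Rightarrow> bool" where
  "cochain_complex C \<longleftrightarrow>
     (\<forall>n. comm_group (grp C n)) \<and>
     (\<forall>n. diff C n \<in> hom (grp C n) (grp C (Suc n))) \<and>
     (\<forall>n. \<forall>x \<in> carrier (grp C n). diff C (Suc n) (diff C n x) = \<one>\<^bsub>grp C (Suc (Suc n))\<^esub>)"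

definition cochain_map :: "'g cochains \<Rightarrow> 'h cochains \<Rightarrow> (nat \<Rightarrow> 'g \<Rightarrow> 'h) \<Rightarrow> bool" where
  "cochain_map C D f \<longleftrightarrow>
     (\<forall>n. f n \<in> hom (grp C n) (grp D n)) \<and>
     (\<forall>n. \<forall>x \<in> carrier (grp C n). diff D n (f n x) = f (Suc n) (diff C n x))"

text \<open>The component \<open>h n\<close> of a cochain homotopy goes from degree \<open>n + 1\<close> to degree \<open>n\<close>.\<close>

definition cochain_homotopic ::
    "'g cochains \<Rightarrow> 'h cochains \<Rightarrow> (nat \<Rightarrow> 'g \<Rightarrow> 'h) \<Rightarrow> (nat \<Rightarrow> 'g \<Rightarrow> 'h) \<Rightarrow> bool" where
  "cochain_homotopic C D f f' \<longleftrightarrow>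
     (\<exists>h. (\<forall>n. h n \<in> hom (grp C (Suc n)) (grp D n)) \<and>
          (\<forall>x \<in> carrier (grp C 0).
             f 0 x \<otimes>\<^bsub>grp D 0\<^esub> inv\<^bsub>grp D 0\<^esub> (f' 0 x) = h 0 (diff C 0 x)) \<and>
          (\<forall>n. \<forall>x \<in> carrier (grp C (Suc n)).
             f (Suc n) x \<otimes>\<^bsub>grp D (Suc n)\<^esub> inv\<^bsub>grp D (Suc n)\<^esub> (f' (Suc n) x)
             = diff D n (h n x) \<otimes>\<^bsub>grp D (Suc n)\<^esub> h (Suc n) (diff C (Suc n) x)))"

definition homotopy_equivalence ::
    "'g cochains \<Rightarrow> 'h cochains \<Rightarrow> (nat \<Rightarrow> 'g \<Rightarrow> 'h) \<Rightarrow> bool" where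
  "homotopy_equivalence C D f \<longleftrightarrow>
     cochain_complex C \<and> cochain_complex D \<and> cochain_map C D f \<and>
     (\<exists>g. cochain_map D C g \<and>
          cochain_homotopic C C (\<lambda>n. g n \<circ> f n) (\<lambda>n. id) \<and>
          cochain_homotopic D D (\<lambda>n. f n \<circ> g n) (\<lambda>n. id))"

definition cocycles :: "'g cochains \<Rightarrow> nat \<Rightarrow> 'g set" where
  "cocycles C n = kernel (grp C n) (grp C (Suc n)) (diff C n)"

definition coboundaries :: "'g cochains \<Rightarrow> nat \<Rightarrow> 'g set" where
  "coboundaries C n =
     (case n of 0 \<Rightarrow> {\<one>\<^bsub>grp C 0\<^esub>} | Suc m \<Rightarrow> diff C m ` carrier (grp C m))"

definition cohomology :: "'g cochains \<Rightarrow> nat \<Rightarrow> 'g set monoid" where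
  "cohomology C n = (grp C n)\<lparr>carrier := cocycles C n\<rparr> Mod coboundaries C n"

text \<open>On the class of a cocycle \<open>z\<close> this gives the class of \<open>f n z\<close>.\<close>

definition cohomology_map ::
    "'h cochains \<Rightarrow> (nat \<Rightarrow> 'g \<Rightarrow> 'h) \<Rightarrow> nat \<Rightarrow> 'g set \<Rightarrow> 'h set" where
  "cohomology_map D f n X = coboundaries D n <#>\<^bsub>grp D n\<^esub> f n ` X"

lemma cohomology_map_coset:
  assumes C: "cochain_complex C" and D: "cochain_complex D" and f: "cochain_map C D f"
    and z: "z \<in> cocycles C n"
  shows "cohomology_map D f n (coboundaries C n #>\<^bsub>grp C n\<^esub> z)
         = coboundaries D n #>\<^bsub>grp D n\<^esub> f n z"
proof -
  interpret D: comm_group "grp D n" using D by (simp add: cochain_complex_def)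
  have z': "z \<in> carrier (grp C n)" using z by (simp add: cocycles_def kernel_def)
  have fh: "f n \<in> hom (grp C n) (grp D n)" using f by (simp add: cochain_map_def)
  have fz: "f n z \<in> carrier (grp D n)" using fh z' by (auto simp: hom_def)
  have dC: "diff C m x \<in> carrier (grp C (Suc m))" if "x \<in> carrier (grp C m)" for m x
    using C that by (auto simp: cochain_complex_def hom_def)
  have dD: "diff D m \<in> hom (grp D m) (grp D (Suc m))" for m
    using D by (simp add: cochain_complex_def)
  have g: "group (grp C m)" "group (grp D m)" for m
    using C D by (auto simp: cochain_complex_def comm_group_def)
  have BC: "b \<in> carrier (grp C n)" "f n b \<in> coboundaries D n" if b: "b \<in> coboundaries C n" for b
  proof -
    have "b \<in> carrier (grp C n) \<and> f n b \<in> coboundaries D n"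
    proof (cases n)
      case 0
      with b have "b = \<one>\<^bsub>grp C 0\<^esub>" by (simp add: coboundaries_def)
      with 0 show ?thesis using hom_one[OF fh g] g(1)[of 0]
        by (simp add: coboundaries_def group.is_monoid monoid.one_closed)
    next
      case (Suc m)
      with b obtain x where x: "x \<in> carrier (grp C m)" "b = diff C m x"
        by (auto simp: coboundaries_def)
      have "f m x \<in> carrier (grp D m)" "diff D m (f m x) = f n b"
        using f x Suc by (auto simp: cochain_map_def hom_def)
      then show ?thesis using x Suc dC by (force simp: coboundaries_def)
    qed
    then show "b \<in> carrier (grp C n)" "f n b \<in> coboundaries D n" by auto
  qed
  have sg: "subgroup (coboundaries D n) (grp D n)"
  proof (cases n)
    case 0
    then show ?thesis using D.triv_subgroup by (simp add: coboundaries_def)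
  next
    case (Suc m)
    interpret group_hom "grp D m" "grp D (Suc m)" "diff D m"
      using dD g by (simp add: group_hom_def group_hom_axioms_def)
    show ?thesis using img_is_subgroup Suc by (simp add: coboundaries_def)
  qed
  have fbz: "f n (b \<otimes>\<^bsub>grp C n\<^esub> z) = f n b \<otimes>\<^bsub>grp D n\<^esub> f n z"
    if "b \<in> coboundaries C n" for b
    using fh BC(1)[OF that] z' by (auto simp: hom_def)
  have one: "\<one>\<^bsub>grp C n\<^esub> \<in> coboundaries C n"
  proof (cases n)
    case (Suc m)
    then have "diff C m \<in> hom (grp C m) (grp C n)"
      using C by (simp add: cochain_complex_def)
    then have "\<one>\<^bsub>grp C n\<^esub> = diff C m \<one>\<^bsub>grp C m\<^esub>"
      using hom_one g(1) by metis
    with Suc g(1)[of m] show ?thesis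
      by (auto simp: coboundaries_def group.is_monoid monoid.one_closed)
  qed (simp add: coboundaries_def)
  show ?thesis (is "?L = ?R")
  proof
    show "?L \<subseteq> ?R"
    proof
      fix y assume "y \<in> ?L"
      then obtain e b where eb: "e \<in> coboundaries D n" "b \<in> coboundaries C n"
        and "y = e \<otimes>\<^bsub>grp D n\<^esub> f n (b \<otimes>\<^bsub>grp C n\<^esub> z)"
        by (auto simp: cohomology_map_def set_mult_def r_coset_def)
      then have "y = (e \<otimes>\<^bsub>grp D n\<^esub> f n b) \<otimes>\<^bsub>grp D n\<^esub> f n z"
        using fbz BC fz sg by (simp add: D.m_assoc subgroup.mem_carrier)
      moreover have "e \<otimes>\<^bsub>grp D n\<^esub> f n b \<in> coboundaries D n"
        using eb BC sg by (simp add: subgroup.m_closed)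
      ultimately show "y \<in> ?R" by (auto simp: r_coset_def)
    qed
    show "?R \<subseteq> ?L"
    proof
      fix y assume "y \<in> ?R"
      then obtain e where e: "e \<in> coboundaries D n" "y = e \<otimes>\<^bsub>grp D n\<^esub> f n z"
        by (auto simp: r_coset_def)
      have "z = \<one>\<^bsub>grp C n\<^esub> \<otimes>\<^bsub>grp C n\<^esub> z"
        using g(1)[of n] z' by (simp add: group.is_monoid monoid.l_one)
      then have "f n z \<in> f n ` (coboundaries C n #>\<^bsub>grp C n\<^esub> z)"
        using one by (force simp: r_coset_def)
      with e show "y \<in> ?L" unfolding cohomology_map_def set_mult_def by blast
    qed
  qed
qed

definition omit :: "nat \<Rightarrow> 'b list \<Rightarrow> 'b list" where
  "omit i s = take i s @ drop (Suc i) s"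


section \<open>Posets as categories, presheaves and the induced sheaf\<close>

text \<open>A poset is a set \<open>A\<close> with \<^term>\<open>partial_order_on A r\<close>, where \<open>(\<alpha>, \<beta>) \<in> r\<close> stands for
  the existence of the arrow \<open>\<alpha> \<rightarrow> \<beta>\<close>.\<close>

definition is_product :: "'a set \<Rightarrow> 'a rel \<Rightarrow> 'a \<Rightarrow> 'a \<Rightarrow> 'a \<Rightarrow> bool" where
  "is_product A r \<alpha> \<alpha>' \<pi> \<longleftrightarrow>
     \<pi> \<in> A \<and> (\<pi>, \<alpha>) \<in> r \<and> (\<pi>, \<alpha>') \<in> r \<and>
     (\<forall>\<omega> \<in> A. (\<omega>, \<alpha>) \<in> r \<and> (\<omega>, \<alpha>') \<in> r \<longrightarrow> (\<omega>, \<pi>) \<in> r)"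

definition conditional_products :: "'a set \<Rightarrow> 'a rel \<Rightarrow> bool" where
  "conditional_products A r \<longleftrightarrow>
     (\<forall>\<alpha> \<in> A. \<forall>\<alpha>' \<in> A. (\<exists>\<omega> \<in> A. (\<omega>, \<alpha>) \<in> r \<and> (\<omega>, \<alpha>') \<in> r)
        \<longrightarrow> (\<exists>\<pi>. is_product A r \<alpha> \<alpha>' \<pi>))"

text \<open>A contravariant functor to abelian groups consists of groups \<open>G \<alpha>\<close> and, for every arrow
  \<open>\<alpha> \<rightarrow> \<beta>\<close>, a homomorphism \<open>\<rho> \<alpha> \<beta>\<close> from \<open>G \<beta>\<close> to \<open>G \<alpha>\<close>.\<close>

locale contravariant_functor =
  fixes A :: "'a set" and r :: "'a rel"
    and G :: "'a \<Rightarrow> 'g monoid" and \<rho> :: "'a \<Rightarrow> 'a \<Rightarrow> 'g \<Rightarrow> 'g"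
  assumes group: "\<alpha> \<in> A \<Longrightarrow> comm_group (G \<alpha>)"
    and hom: "(\<alpha>, \<beta>) \<in> r \<Longrightarrow> \<rho> \<alpha> \<beta> \<in> hom (G \<beta>) (G \<alpha>)"
    and ident: "\<lbrakk>\<alpha> \<in> A; x \<in> carrier (G \<alpha>)\<rbrakk> \<Longrightarrow> \<rho> \<alpha> \<alpha> x = x"
    and comp: "\<lbrakk>(\<alpha>, \<beta>) \<in> r; (\<beta>, \<gamma>) \<in> r; x \<in> carrier (G \<gamma>)\<rbrakk>
                 \<Longrightarrow> \<rho> \<alpha> \<beta> (\<rho> \<beta> \<gamma> x) = \<rho> \<alpha> \<gamma> x"

definition basic_open :: "'a rel \<Rightarrow> 'a \<Rightarrow> 'a set" where
  "basic_open r \<beta> = {\<alpha>. (\<alpha>, \<beta>) \<in> r}"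

definition canonical_cover :: "'a set \<Rightarrow> 'a rel \<Rightarrow> 'a set set" where
  "canonical_cover A r = basic_open r ` A"

definition alexandrov :: "'a set \<Rightarrow> 'a rel \<Rightarrow> 'a topology" where
  "alexandrov A r = topology_generated_by (canonical_cover A r)"

text \<open>The value of the induced sheaf on \<open>W\<close> is the limit of the groups \<open>G \<omega>\<close> with \<open>\<omega> \<in> W\<close>,
  realised as the compatible families in their product.\<close>

definition induced_sheaf ::
    "'a rel \<Rightarrow> ('a \<Rightarrow> 'g monoid) \<Rightarrow> ('a \<Rightarrow> 'a \<Rightarrow> 'g \<Rightarrow> 'g) \<Rightarrow> 'a set \<Rightarrow> ('a \<Rightarrow> 'g) monoid" where
  "induced_sheaf r G \<rho> W =
     (product_group W G)\<lparr>carrier :=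
        {x \<in> carrier (product_group W G).
           \<forall>\<alpha> \<in> W. \<forall>\<beta> \<in> W. (\<alpha>, \<beta>) \<in> r \<longrightarrow> \<rho> \<alpha> \<beta> (x \<beta>) = x \<alpha>}\<rparr>"

definition sheaf_restriction :: "'a set \<Rightarrow> 'a set \<Rightarrow> ('a \<Rightarrow> 'g) \<Rightarrow> ('a \<Rightarrow> 'g)" where
  "sheaf_restriction V W x = restrict x W"

lemma openin_alexandrov:
  assumes "partial_order_on A r"
  shows "openin (alexandrov A r) W \<longleftrightarrow>
           W \<subseteq> A \<and> (\<forall>\<alpha> \<beta>. (\<alpha>, \<beta>) \<in> r \<and> \<beta> \<in> W \<longrightarrow> \<alpha> \<in> W)"
proof -
  have po: "r \<subseteq> A \<times> A" "trans r" "\<And>\<alpha>. \<alpha> \<in> A \<Longrightarrow> (\<alpha>, \<alpha>) \<in> r"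
    using assms by (auto simp: partial_order_on_def preorder_on_def refl_on_def)
  have "W \<subseteq> A \<and> (\<forall>\<alpha> \<beta>. (\<alpha>, \<beta>) \<in> r \<and> \<beta> \<in> W \<longrightarrow> \<alpha> \<in> W)"
    if "generate_topology_on (canonical_cover A r) W"
    using that
  proof induction
    case (Basis s)
    then show ?case using po(1) transD[OF po(2)]
      by (auto simp: canonical_cover_def basic_open_def)
  qed blast+
  moreover have "generate_topology_on (canonical_cover A r) W"
    if W: "W \<subseteq> A" "\<forall>\<alpha> \<beta>. (\<alpha>, \<beta>) \<in> r \<and> \<beta> \<in> W \<longrightarrow> \<alpha> \<in> W"
  proof -
    have "W = \<Union>(basic_open r ` W)"
      using W po(3) unfolding basic_open_def by blast
    moreover have "generate_topology_on (canonical_cover A r) (\<Union>(basic_open r ` W))"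
      using W by (intro generate_topology_on.UN)
        (auto simp: canonical_cover_def intro: generate_topology_on.Basis)
    ultimately show ?thesis by simp
  qed
  ultimately show ?thesis
    by (auto simp: alexandrov_def openin_topology_generated_by_iff)
qed

context contravariant_functor
begin

lemma comm_group_induced_sheaf:
  assumes "W \<subseteq> A"
  shows "comm_group (induced_sheaf r G \<rho> W)"
proof -
  have g: "\<And>\<alpha>. \<alpha> \<in> W \<Longrightarrow> comm_group (G \<alpha>)" using assms group by auto
  then have gg: "\<And>\<alpha>. \<alpha> \<in> W \<Longrightarrow> group (G \<alpha>)" by (simp add: comm_group_def)
  have h: "\<And>\<alpha> \<beta>. (\<alpha>, \<beta>) \<in> r \<Longrightarrow> \<alpha> \<in> W \<Longrightarrow> \<beta> \<in> W \<Longrightarrow> group_hom (G \<beta>) (G \<alpha>) (\<rho> \<alpha> \<beta>)"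
    using hom gg by (simp add: group_hom_def group_hom_axioms_def)
  interpret P: group "product_group W G" using gg by simp
  have "subgroup (carrier (induced_sheaf r G \<rho> W)) (product_group W G)"
  proof (rule P.subgroupI)
    show "carrier (induced_sheaf r G \<rho> W) \<subseteq> carrier (product_group W G)"
      by (auto simp: induced_sheaf_def)
    have "\<one>\<^bsub>product_group W G\<^esub> \<in> carrier (induced_sheaf r G \<rho> W)"
      using P.one_closed h by (auto simp: induced_sheaf_def group_hom.hom_one)
    then show "carrier (induced_sheaf r G \<rho> W) \<noteq> {}" by blast
  next
    fix x assume x: "x \<in> carrier (induced_sheaf r G \<rho> W)"
    then have xP: "x \<in> carrier (product_group W G)" by (simp add: induced_sheaf_def)
    then have xc: "x \<omega> \<in> carrier (G \<omega>)" if "\<omega> \<in> W" for \<omega>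
      using that by (auto simp: PiE_mem)
    from xP show "inv\<^bsub>product_group W G\<^esub> x \<in> carrier (induced_sheaf r G \<rho> W)"
      using P.inv_closed[of x] x h gg
      by (auto simp: induced_sheaf_def group_hom.hom_inv[OF h] xc)
  next
    fix x y assume x: "x \<in> carrier (induced_sheaf r G \<rho> W)"
      and y: "y \<in> carrier (induced_sheaf r G \<rho> W)"
    then have P: "x \<in> carrier (product_group W G)" "y \<in> carrier (product_group W G)"
      by (simp_all add: induced_sheaf_def)
    then have c: "x \<omega> \<in> carrier (G \<omega>)" "y \<omega> \<in> carrier (G \<omega>)" if "\<omega> \<in> W" for \<omega>
      using that by (auto simp: PiE_mem)
    from P show "x \<otimes>\<^bsub>product_group W G\<^esub> y \<in> carrier (induced_sheaf r G \<rho> W)"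
      using P.m_closed[of x y] x y h
      by (auto simp: induced_sheaf_def group_hom.hom_mult[OF h] c)
  qed
  then have "group ((product_group W G)\<lparr>carrier := carrier (induced_sheaf r G \<rho> W)\<rparr>)"
    by (rule subgroup.subgroup_is_group) (rule P.group_axioms)
  then have "group (induced_sheaf r G \<rho> W)" by (simp add: induced_sheaf_def)
  then show ?thesis
  proof (rule group.group_comm_groupI)
    fix x y assume "x \<in> carrier (induced_sheaf r G \<rho> W)" "y \<in> carrier (induced_sheaf r G \<rho> W)"
    then show "x \<otimes>\<^bsub>induced_sheaf r G \<rho> W\<^esub> y = y \<otimes>\<^bsub>induced_sheaf r G \<rho> W\<^esub> x"
      using g by (auto simp: induced_sheaf_def PiE_mem fun_eq_iff restrict_def
        intro!: comm_monoid.m_comm[OF comm_group.axioms(1)])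
  qed
qed

text \<open>The identification of the value on \<open>U\<^sup>\<alpha>\<close> with \<open>G \<alpha>\<close> is evaluation at \<open>\<alpha>\<close>.\<close>

lemma eval_iso:
  assumes "partial_order_on A r" and "\<alpha> \<in> A"
  shows "(\<lambda>x. x \<alpha>) \<in> iso (induced_sheaf r G \<rho> (basic_open r \<alpha>)) (G \<alpha>)"
proof -
  let ?U = "basic_open r \<alpha>"
  let ?S = "induced_sheaf r G \<rho> ?U"
  have po: "r \<subseteq> A \<times> A" "trans r" "(\<alpha>, \<alpha>) \<in> r"
    using assms by (auto simp: partial_order_on_def preorder_on_def refl_on_def)
  then have a: "\<alpha> \<in> ?U" by (simp add: basic_open_def)
  have "(\<lambda>x. x \<alpha>) \<in> hom ?S (G \<alpha>)"
    using a by (auto simp: hom_def induced_sheaf_def PiE_mem)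
  moreover have "bij_betw (\<lambda>x. x \<alpha>) (carrier ?S) (carrier (G \<alpha>))"
  proof (rule bij_betw_byWitness[where f' = "\<lambda>g. \<lambda>\<omega>\<in>?U. \<rho> \<omega> \<alpha> g"])
    show "\<forall>x\<in>carrier ?S. (\<lambda>\<omega>\<in>?U. \<rho> \<omega> \<alpha> (x \<alpha>)) = x"
    proof
      fix x assume x: "x \<in> carrier ?S"
      show "(\<lambda>\<omega>\<in>?U. \<rho> \<omega> \<alpha> (x \<alpha>)) = x"
      proof (rule extensionalityI[of _ ?U])
        show "x \<in> extensional ?U" using x by (auto simp: induced_sheaf_def PiE_def)
        show "(\<lambda>\<omega>\<in>?U. \<rho> \<omega> \<alpha> (x \<alpha>)) \<omega> = x \<omega>" if "\<omega> \<in> ?U" for \<omega>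
          using that x a by (auto simp: induced_sheaf_def basic_open_def)
      qed simp
    qed
    show "\<forall>g\<in>carrier (G \<alpha>). (\<lambda>\<omega>\<in>?U. \<rho> \<omega> \<alpha> g) \<alpha> = g"
      using a ident assms(2) by simp
    show "(\<lambda>x. x \<alpha>) ` carrier ?S \<subseteq> carrier (G \<alpha>)"
      using a by (auto simp: induced_sheaf_def PiE_mem)
    show "(\<lambda>g. \<lambda>\<omega>\<in>?U. \<rho> \<omega> \<alpha> g) ` carrier (G \<alpha>) \<subseteq> carrier ?S"
      using comp hom[unfolded hom_def]
      by (auto simp: induced_sheaf_def basic_open_def PiE_def Pi_def)
  qed
  ultimately show ?thesis by (simp add: iso_def)
qed

lemma gluing:
  assumes "partial_order_on A r"
    and "\<And>V. V \<in> \<V> \<Longrightarrow> openin (alexandrov A r) V"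
    and "\<And>V. V \<in> \<V> \<Longrightarrow> x V \<in> carrier (induced_sheaf r G \<rho> V)"
    and "\<And>V V'. V \<in> \<V> \<Longrightarrow> V' \<in> \<V> \<Longrightarrow>
           sheaf_restriction V (V \<inter> V') (x V) = sheaf_restriction V' (V \<inter> V') (x V')"
  shows "\<exists>!y. y \<in> carrier (induced_sheaf r G \<rho> (\<Union>\<V>)) \<and>
           (\<forall>V \<in> \<V>. sheaf_restriction (\<Union>\<V>) V y = x V)"
proof -
  have down: "\<alpha> \<in> V" if "V \<in> \<V>" "(\<alpha>, \<beta>) \<in> r" "\<beta> \<in> V" for V \<alpha> \<beta>
    using assms(2)[OF that(1)] that openin_alexandrov[OF assms(1)] by blast
  have agree: "x V \<omega> = x V' \<omega>" if "V \<in> \<V>" "V' \<in> \<V>" "\<omega> \<in> V" "\<omega> \<in> V'" for V V' \<omega>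
    using fun_cong[OF assms(4)[OF that(1,2)], of \<omega>] that by (simp add: sheaf_restriction_def)
  define pick where "pick \<omega> = (SOME V. V \<in> \<V> \<and> \<omega> \<in> V)" for \<omega>
  define y where "y = (\<lambda>\<omega>\<in>\<Union>\<V>. x (pick \<omega>) \<omega>)"
  have y: "y \<omega> = x V \<omega>" if "V \<in> \<V>" "\<omega> \<in> V" for V \<omega>
  proof -
    have "pick \<omega> \<in> \<V> \<and> \<omega> \<in> pick \<omega>"
      unfolding pick_def by (rule someI[of _ V]) (use that in simp)
    then show ?thesis using that agree[of "pick \<omega>" V \<omega>] by (auto simp: y_def)
  qed
  have xc: "x V \<omega> \<in> carrier (G \<omega>)" if "V \<in> \<V>" "\<omega> \<in> V" for V \<omega>
    using assms(3)[OF that(1)] that(2) by (auto simp: induced_sheaf_def PiE_mem)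
  have xr: "\<rho> \<alpha> \<beta> (x V \<beta>) = x V \<alpha>" if "V \<in> \<V>" "(\<alpha>, \<beta>) \<in> r" "\<beta> \<in> V" for V \<alpha> \<beta>
    using assms(3)[OF that(1)] that down[OF that] by (auto simp: induced_sheaf_def)
  have yext: "y \<in> extensional (\<Union>\<V>)" by (simp add: y_def)
  show ?thesis
  proof (rule ex1I[of _ y], intro conjI ballI)
    have "y \<in> (\<Pi>\<^sub>E \<omega>\<in>\<Union>\<V>. carrier (G \<omega>))"
      using yext xc y by (auto simp: PiE_def Pi_def)
    moreover have "\<rho> \<alpha> \<beta> (y \<beta>) = y \<alpha>" if "\<beta> \<in> \<Union>\<V>" "(\<alpha>, \<beta>) \<in> r" for \<alpha> \<beta>
    proof -
      from that(1) obtain V where V: "V \<in> \<V>" "\<beta> \<in> V" by (rule UnionE)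
      then show ?thesis using xr[OF V(1) that(2) V(2)] y[OF V] y[OF V(1) down[OF V(1) that(2) V(2)]]
        by simp
    qed
    ultimately show "y \<in> carrier (induced_sheaf r G \<rho> (\<Union>\<V>))"
      unfolding induced_sheaf_def by simp blast
    show "sheaf_restriction (\<Union>\<V>) V y = x V" if "V \<in> \<V>" for V
    proof (rule extensionalityI[of _ V])
      show "x V \<in> extensional V"
        using assms(3)[OF that] by (auto simp: induced_sheaf_def PiE_def)
    qed (use that y in \<open>auto simp: sheaf_restriction_def\<close>)
  next
    fix y' assume y': "y' \<in> carrier (induced_sheaf r G \<rho> (\<Union>\<V>)) \<and>
      (\<forall>V\<in>\<V>. sheaf_restriction (\<Union>\<V>) V y' = x V)"
    show "y' = y"
    proof (rule extensionalityI[of _ "\<Union>\<V>"])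
      show "y' \<in> extensional (\<Union>\<V>)" using y' by (auto simp: induced_sheaf_def PiE_def)
      fix \<omega> assume "\<omega> \<in> \<Union>\<V>"
      then obtain V where V: "V \<in> \<V>" "\<omega> \<in> V" by blast
      then have "restrict y' V \<omega> = x V \<omega>" using y' by (auto simp: sheaf_restriction_def)
      then show "y' \<omega> = y \<omega>" using V y by simp
    qed (rule yext)
  qed
qed

end


section \<open>The Cech complex and the nerve complex\<close>

definition cech_simplices :: "'a set set \<Rightarrow> nat \<Rightarrow> 'a set list set" where
  "cech_simplices \<U> n = {s. length s = Suc n \<and> set s \<subseteq> \<U> \<and> \<Inter>(set s) \<noteq> {}}"

text \<open>Here \<open>F\<close> is a presheaf of abelian groups, with \<open>res V W\<close> the restriction
  from \<open>F V\<close> to \<open>F W\<close>.\<close>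

definition cech_complex ::
    "'a set set \<Rightarrow> ('a set \<Rightarrow> 'h monoid) \<Rightarrow> ('a set \<Rightarrow> 'a set \<Rightarrow> 'h \<Rightarrow> 'h)
     \<Rightarrow> ('a set list \<Rightarrow> 'h) cochains" where
  "cech_complex \<U> F res =
     \<lparr>grp = (\<lambda>n. product_group (cech_simplices \<U> n) (\<lambda>s. F (\<Inter>(set s)))),
      diff = (\<lambda>n c. \<lambda>s \<in> cech_simplices \<U> (Suc n).
        \<Otimes>\<^bsub>F (\<Inter>(set s))\<^esub> i \<in> {0..Suc n}.
          res (\<Inter>(set (omit i s))) (\<Inter>(set s)) (c (omit i s)) [^]\<^bsub>F (\<Inter>(set s))\<^esub> ((-1)^i :: int))\<rparr>"

definition nerve_simplices :: "'a set \<Rightarrow> 'a rel \<Rightarrow> nat \<Rightarrow> 'a list set" where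
  "nerve_simplices A r n =
     {s. length s = Suc n \<and> set s \<subseteq> A \<and> (\<forall>i < n. (s ! i, s ! Suc i) \<in> r)}"

definition nerve_complex ::
    "'a set \<Rightarrow> 'a rel \<Rightarrow> ('a \<Rightarrow> 'g monoid) \<Rightarrow> ('a \<Rightarrow> 'a \<Rightarrow> 'g \<Rightarrow> 'g)
     \<Rightarrow> ('a list \<Rightarrow> 'g) cochains" where
  "nerve_complex A r G \<rho> =
     \<lparr>grp = (\<lambda>n. product_group (nerve_simplices A r n) (\<lambda>s. G (s ! 0))),
      diff = (\<lambda>n c. \<lambda>s \<in> nerve_simplices A r (Suc n).
        \<rho> (s ! 0) (s ! 1) (c (omit 0 s)) \<otimes>\<^bsub>G (s ! 0)\<^esub>
        (\<Otimes>\<^bsub>G (s ! 0)\<^esub> i \<in> {1..Suc n}. c (omit i s) [^]\<^bsub>G (s ! 0)\<^esub> ((-1)^i :: int)))\<rparr>"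

text \<open>The value of \<open>c\<close> at \<open>(U\<^sup>\<alpha>\<^sub>0, \<dots>, U\<^sup>\<alpha>\<^sub>n)\<close> is a compatible family on
  \<open>U\<^sup>\<alpha>\<^sub>0\<close>, which is then evaluated at \<open>\<alpha>\<^sub>0\<close>.\<close>

definition j_star ::
    "'a set \<Rightarrow> 'a rel \<Rightarrow> nat \<Rightarrow> ('a set list \<Rightarrow> 'a \<Rightarrow> 'g) \<Rightarrow> ('a list \<Rightarrow> 'g)" where
  "j_star A r n c = (\<lambda>s \<in> nerve_simplices A r n. c (map (basic_open r) s) (s ! 0))"

end

theory Submission
  imports Defs "HOL-Library.Poly_Mapping"
begin

text \<open>
  Since products exist conditionally, the covering is closed under non-empty intersections, and
  \<open>j\<^sup>*\<close> restricts a Cech cochain to the sequences of members of the covering that increase for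
  inclusion. Prepending \<open>\<Inter>s\<close> is a contraction of the complex of sequences of sets that contain
  \<open>\<Inter>s\<close>, so one can define recursively \<open>H s = 0\<close> if \<open>s\<close> is increasing and
  \<open>H s = \<Inter>s # (s - H (\<partial> s))\<close> otherwise. Then \<open>p = id - \<partial> H - H \<partial>\<close> fixes the increasing
  sequences and satisfies \<open>p s = \<Inter>s # p (\<partial> s)\<close> on the others, hence has values in
  combinations of increasing sequences. Dually, \<open>H\<close> gives operators on Cech cochains with values
  in the kernel of \<open>j\<^sup>*\<close> which contract that kernel.
\<close>

section \<open>Formal chains of lists\<close>

text \<open>The map p is a barycentric subdivision in which \<Inter>s serves as the barycentre of s:
  for incomparable U, V it sends [U, V] to [U \<inter> V, V] - [U \<inter> V, U]. Ordinary
  subdivision would also break up the increasing lists, and the composite on the nerve side would be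
  the identity only up to a second homotopy. Leaving these lists alone makes that composite equal to
  the identity, so H is the only homotopy to be built. The image of p is increasing by induction on
  length: p (\<partial> s) combines increasing lists of sets that contain \<Inter>s, and such a list
  stays increasing when \<Inter>s is put in front. The same containment serves the coefficients: a
  value c t can be restricted to \<Inter>s only if every set in t contains \<Inter>s. Hence supports
  are tracked throughout, for H as well as for p.\<close>

lemma length_omit [simp]: "i < length s \<Longrightarrow> length (omit i s) = length s - 1"
  by (simp add: omit_def)

lemma set_omit_subset: "set (omit i s) \<subseteq> set s"
  by (auto simp: omit_def dest: in_set_takeD in_set_dropD)

lemma omit_0_Cons [simp]: "omit 0 (x # s) = s"
  by (simp add: omit_def)

lemma omit_Suc_Cons [simp]: "omit (Suc i) (x # s) = x # omit i s"
  by (simp add: omit_def)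

lemma map_omit: "map f (omit i s) = omit i (map f s)"
  by (simp add: omit_def take_map drop_map)

text \<open>Faces of increasing lists are again increasing, so these lists span a
  subcomplex.\<close>

lemma sorted_wrt_omit:
  assumes "sorted_wrt R s"
  shows "sorted_wrt R (omit i s)"
proof -
  have "sorted_wrt R (take i s @ drop i s)" using assms by simp
  then have "sorted_wrt R (take i s)" "sorted_wrt R (drop i s)"
    "\<forall>x\<in>set (take i s). \<forall>y\<in>set (drop i s). R x y"
    by (auto simp only: sorted_wrt_append)
  moreover have "set (drop (Suc i) s) \<subseteq> set (drop i s)"
    by (simp add: set_drop_subset_set_drop)
  moreover have "sorted_wrt R (drop (Suc i) s)"
    using assms by (simp add: sorted_wrt_drop)
  ultimately show ?thesis by (auto simp: omit_def sorted_wrt_append)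
qed

text \<open>The boundary of a one-element list is the generator \<open>[]\<close>, so this is the
  augmented complex. With the empty list included, prepending an element is a contraction in every
  length.\<close>

definition list_boundary :: "'b list \<Rightarrow> 'b list \<Rightarrow>\<^sub>0 int" where
  "list_boundary s = (\<Sum>i<length s. frag_cmul ((-1)^i) (frag_of (omit i s)))"

abbreviation boundary :: "('b list \<Rightarrow>\<^sub>0 int) \<Rightarrow> ('b list \<Rightarrow>\<^sub>0 int)" where
  "boundary \<equiv> frag_extend list_boundary"

definition cone :: "'b \<Rightarrow> ('b list \<Rightarrow>\<^sub>0 int) \<Rightarrow> ('b list \<Rightarrow>\<^sub>0 int)" where
  "cone x = frag_extend (\<lambda>s. frag_of (x # s))"

lemma cone_simps [simp]:
  "cone x 0 = 0" "cone x (frag_of s) = frag_of (x # s)" "cone x (z - w) = cone x z - cone x w"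
  by (simp_all add: cone_def frag_extend_diff)

lemma keys_cone: "Poly_Mapping.keys (cone x z) \<subseteq> (#) x ` Poly_Mapping.keys z"
  unfolding cone_def by (rule order_trans[OF keys_frag_extend]) auto

lemma list_boundary_Nil [simp]: "list_boundary [] = 0"
  by (simp add: list_boundary_def)

text \<open>Omitting the head leaves \<open>s\<close>. Omitting a later entry keeps the head and
  shifts the index by one, whence the minus sign.\<close>

lemma list_boundary_Cons: "list_boundary (x # s) = frag_of s - cone x (list_boundary s)"
  by (simp add: list_boundary_def sum.lessThan_Suc_shift cone_def frag_extend_sum
      frag_extend_cmul sum_negf[symmetric] del: sum.lessThan_Suc)

lemma keys_list_boundary:
  "Poly_Mapping.keys (list_boundary s) \<subseteq> (\<lambda>i. omit i s) ` {..<length s}"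
  unfolding list_boundary_def
  by (rule order_trans[OF keys_sum]) auto

lemma frag_extend_list_boundary:
  "frag_extend f (list_boundary s) = (\<Sum>i<length s. frag_cmul ((-1)^i) (f (omit i s)))"
  by (simp add: list_boundary_def frag_extend_sum frag_extend_cmul)

lemma keys_frag_extend_list_boundary:
  assumes "\<And>i. i < length s \<Longrightarrow> Poly_Mapping.keys (f (omit i s)) \<subseteq> S"
  shows "Poly_Mapping.keys (frag_extend f (list_boundary s)) \<subseteq> S"
proof -
  have "Poly_Mapping.keys (f t) \<subseteq> S" if "t \<in> Poly_Mapping.keys (list_boundary s)" for t
    using assms subsetD[OF keys_list_boundary that] by auto
  then show ?thesis using keys_frag_extend[of f "list_boundary s"] by blast
qed

text \<open>The contracting homotopy of the augmented complex, extended from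
  \<open>list_boundary_Cons\<close> by linearity.\<close>

lemma boundary_cone: "boundary (cone x z) = z - cone x (boundary z)"
  using subset_UNIV
proof (induction z rule: frag_induction)
  case (diff a b)
  then show ?case by (simp add: frag_extend_diff)
qed (simp_all add: list_boundary_Cons)

text \<open>The cone identity replaces the usual cancellation of pairs of faces: for
  \<open>x # s\<close> the two copies of \<open>list_boundary s\<close> cancel and the rest is the
  cone over the induction hypothesis.\<close>

lemma boundary_list_boundary [simp]: "boundary (list_boundary s) = 0"
  by (induction s) (simp_all add: list_boundary_Cons frag_extend_diff boundary_cone)

lemma keys_minus_subset:
  assumes "Poly_Mapping.keys z \<subseteq> S" "Poly_Mapping.keys w \<subseteq> S"
  shows "Poly_Mapping.keys (z - w) \<subseteq> S"
  using assms keys_diff[of z w] by blast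


section \<open>Contracting lists of sets onto inclusion chains\<close>

text \<open>Coning off at the intersection contracts the lists that contain a given set; the recursion
  glues these contractions along the boundary, starting from zero on chains.\<close>

function chain_homotopy :: "'a set list \<Rightarrow> 'a set list \<Rightarrow>\<^sub>0 int" where
  "chain_homotopy s = (if sorted_wrt (\<subseteq>) s then 0
     else cone (\<Inter>(set s))
       (frag_of s - (\<Sum>i<length s. frag_cmul ((-1)^i) (chain_homotopy (omit i s)))))"
  by pat_completeness auto
termination
  by (relation "measure length") (auto simp: neq_Nil_conv)

declare chain_homotopy.simps [simp del]

lemma chain_homotopy_chain [simp]: "sorted_wrt (\<subseteq>) s \<Longrightarrow> chain_homotopy s = 0"
  by (simp add: chain_homotopy.simps)

lemma chain_homotopy_rec:
  "\<not> sorted_wrt (\<subseteq>) s \<Longrightarrow>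
    chain_homotopy s = cone (\<Inter>(set s)) (frag_of s - frag_extend chain_homotopy (list_boundary s))"
  by (simp add: chain_homotopy.simps[of s] frag_extend_list_boundary)

definition chain_projection :: "'a set list \<Rightarrow> 'a set list \<Rightarrow>\<^sub>0 int" where
  "chain_projection s =
     frag_of s - boundary (chain_homotopy s) - frag_extend chain_homotopy (list_boundary s)"

text \<open>The homotopy vanishes on \<open>s\<close> and on all its faces, which are increasing
  too.\<close>

lemma chain_projection_chain:
  assumes "sorted_wrt (\<subseteq>) s"
  shows "chain_projection s = frag_of s"
  using assms keys_list_boundary[of s]
  by (auto simp: chain_projection_def sorted_wrt_omit intro!: frag_extend_eq_0)

lemma frag_extend_chain_projection:
  "frag_extend chain_projection z =
     z - boundary (frag_extend chain_homotopy z) - frag_extend chain_homotopy (boundary z)"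
  using subset_UNIV
  by (induction z rule: frag_induction) (simp_all add: chain_projection_def frag_extend_diff)

text \<open>Expanding the boundary of the cone in H s cancels both \<open>frag_of s\<close> and H
  (\<partial> s), leaving the cone over \<partial> s - \<partial> H \<partial> s. This is p
  (\<partial> s), because its remaining term H \<partial> \<partial> s is zero.\<close>

lemma chain_projection_rec:
  assumes "\<not> sorted_wrt (\<subseteq>) s"
  shows "chain_projection s = cone (\<Inter>(set s)) (frag_extend chain_projection (list_boundary s))"
  using assms
  by (simp add: chain_projection_def[of s] chain_homotopy_rec frag_extend_chain_projection
      list_boundary_Cons boundary_cone frag_extend_diff)

lemma omit_in_lists: "s \<in> lists S \<Longrightarrow> omit i s \<in> lists S"
  using set_omit_subset by fastforce

locale intersection_closed =
  fixes \<U> :: "'a set set"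
  assumes Int_closed: "\<lbrakk>U \<in> \<U>; V \<in> \<U>; U \<inter> V \<noteq> {}\<rbrakk> \<Longrightarrow> U \<inter> V \<in> \<U>"
begin

lemma Inter_closed:
  assumes "finite S" "S \<noteq> {}" "S \<subseteq> \<U>" "\<Inter>S \<noteq> {}"
  shows "\<Inter>S \<in> \<U>"
  using assms
proof (induction S rule: finite_ne_induct)
  case (insert U S)
  then show ?case using Int_closed[of U "\<Inter>S"] by auto
qed simp

text \<open>Not being increasing excludes the empty list, whose intersection would be the whole
  type. The non-empty \<open>W\<close> makes the intersection non-empty, as closure demands.\<close>

lemma Inter_set_in:
  assumes "W \<noteq> {}" "s \<in> lists {U \<in> \<U>. W \<subseteq> U}" "\<not> sorted_wrt (\<subseteq>) s"
  shows "\<Inter>(set s) \<in> {U \<in> \<U>. W \<subseteq> U}"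
proof -
  have "s \<noteq> []" "W \<subseteq> \<Inter>(set s)" using assms by auto
  then show ?thesis using Inter_closed[of "set s"] assms by auto
qed

text \<open>Each new entry is an intersection of sets of the covering that contain \<open>W\<close>,
  so it stays in the covering and still contains \<open>W\<close>.\<close>

lemma keys_chain_homotopy:
  assumes "W \<noteq> {}" "s \<in> lists {U \<in> \<U>. W \<subseteq> U}"
  shows "Poly_Mapping.keys (chain_homotopy s)
           \<subseteq> {t \<in> lists {U \<in> \<U>. W \<subseteq> U}. length t = Suc (length s)}"
  using assms(2)
proof (induction s rule: length_induct)
  case (1 s)
  show ?case
  proof (cases "sorted_wrt (\<subseteq>) s")
    case False
    let ?S = "{t \<in> lists {U \<in> \<U>. W \<subseteq> U}. length t = length s}"
    have "Poly_Mapping.keys (chain_homotopy (omit i s)) \<subseteq> ?S" if "i < length s" for i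
    proof -
      have "length (omit i s) < length s" "Suc (length (omit i s)) = length s"
        using that by auto
      then show ?thesis using 1(1)[rule_format, OF _ omit_in_lists[OF 1(2), of i]] by simp
    qed
    then have "Poly_Mapping.keys (frag_extend chain_homotopy (list_boundary s)) \<subseteq> ?S"
      by (rule keys_frag_extend_list_boundary)
    then have "Poly_Mapping.keys (frag_of s - frag_extend chain_homotopy (list_boundary s)) \<subseteq> ?S"
      using 1(2) by (intro keys_minus_subset) (auto simp: keys_frag_of)
    then have "Poly_Mapping.keys (chain_homotopy s) \<subseteq> (#) (\<Inter>(set s)) ` ?S"
      unfolding chain_homotopy_rec[OF False] by (rule order_trans[OF keys_cone image_mono])
    also have "\<dots> \<subseteq> {t \<in> lists {U \<in> \<U>. W \<subseteq> U}. length t = Suc (length s)}"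
      using Inter_set_in[OF assms(1) 1(2) False] by (intro image_subsetI) simp
    finally show ?thesis .
  qed simp
qed

lemma keys_chain_projection:
  assumes "W \<noteq> {}" "s \<in> lists {U \<in> \<U>. W \<subseteq> U}"
  shows "Poly_Mapping.keys (chain_projection s)
           \<subseteq> {t \<in> lists {U \<in> \<U>. W \<subseteq> U}. length t = length s \<and> sorted_wrt (\<subseteq>) t}"
  using assms
proof (induction s arbitrary: W rule: length_induct)
  case (1 s)
  show ?case
  proof (cases "sorted_wrt (\<subseteq>) s")
    case True
    then show ?thesis using 1 by (simp add: chain_projection_chain)
  next
    case False
    \<comment> \<open>The induction hypothesis is used for the faces with \<open>?V\<close> instead
      of \<open>W\<close>. Knowing only that their images contain \<open>W\<close> would not make
      the lists increasing once \<open>?V\<close> is prepended; this is why \<open>W\<close> is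
      generalised.\<close>
    let ?V = "\<Inter>(set s)"
    let ?S = "{t \<in> lists {U \<in> \<U>. ?V \<subseteq> U}. Suc (length t) = length s \<and> sorted_wrt (\<subseteq>) t}"
    have V: "?V \<noteq> {}" "s \<in> lists {U \<in> \<U>. ?V \<subseteq> U}" "?V \<in> {U \<in> \<U>. W \<subseteq> U}"
      using Inter_set_in[OF 1(2,3) False] 1(2,3) by auto
    have "Poly_Mapping.keys (chain_projection (omit i s)) \<subseteq> ?S" if "i < length s" for i
    proof -
      have *: "length (omit i s) < length s" "Suc (length (omit i s)) = length s"
        using that by auto
      have "Poly_Mapping.keys (chain_projection (omit i s)) \<subseteq>
        {t \<in> lists {U \<in> \<U>. ?V \<subseteq> U}. length t = length (omit i s) \<and> sorted_wrt (\<subseteq>) t}"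
        by (rule 1(1)[rule_format, OF *(1) V(1) omit_in_lists[OF V(2)]])
      then show ?thesis using *(2) by auto
    qed
    then have "Poly_Mapping.keys (frag_extend chain_projection (list_boundary s)) \<subseteq> ?S"
      by (rule keys_frag_extend_list_boundary)
    then have "Poly_Mapping.keys (chain_projection s) \<subseteq> (#) ?V ` ?S"
      unfolding chain_projection_rec[OF False] by (rule order_trans[OF keys_cone image_mono])
    also have "\<dots> \<subseteq> {t \<in> lists {U \<in> \<U>. W \<subseteq> U}. length t = length s \<and> sorted_wrt (\<subseteq>) t}"
    proof (rule image_subsetI)
      fix t assume t: "t \<in> ?S"
      then have *: "\<forall>U\<in>set t. U \<in> \<U> \<and> ?V \<subseteq> U"
        by (simp only: mem_Collect_eq in_lists_conv_set) blast
      moreover have "W \<subseteq> U" if "U \<in> set t" for U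
        by (rule order_trans[of W ?V U]) (use that V(3) * in simp_all)
      ultimately show "?V # t \<in> {t \<in> lists {U \<in> \<U>. W \<subseteq> U}. length t = length s \<and> sorted_wrt (\<subseteq>) t}"
        using t V(3) by (simp add: in_lists_conv_set)
    qed
    finally show ?thesis .
  qed
qed

end

section \<open>Evaluating formal chains in an abelian group\<close>

context comm_group
begin

text \<open>The extension of \<open>f\<close> to the free abelian group on its arguments. Later side
  conditions mention only the support of the chain, because a restricted cochain takes values in the
  right group only on suitable lists.\<close>

definition frag_eval :: "('i \<Rightarrow> 'a) \<Rightarrow> ('i \<Rightarrow>\<^sub>0 int) \<Rightarrow> 'a" where
  "frag_eval f z = (\<Otimes>x\<in>Poly_Mapping.keys z. f x [^] Poly_Mapping.lookup z x)"

text \<open>Points outside the support contribute the neutral element, so chains can be compared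
  over a common finite index set.\<close>

lemma frag_eval_superset:
  assumes "finite T" "Poly_Mapping.keys z \<subseteq> T" "f \<in> T \<rightarrow> carrier G"
  shows "frag_eval f z = (\<Otimes>x\<in>T. f x [^] Poly_Mapping.lookup z x)"
  unfolding frag_eval_def
  by (rule finprod_mono_neutral_cong_left) (use assms in \<open>auto simp: in_keys_iff\<close>)

lemma frag_eval_closed [simp]:
  assumes "f \<in> Poly_Mapping.keys z \<rightarrow> carrier G"
  shows "frag_eval f z \<in> carrier G"
  unfolding frag_eval_def using assms by (intro finprod_closed) auto

lemma frag_eval_0 [simp]: "frag_eval f 0 = \<one>"
  by (simp add: frag_eval_def)

lemma frag_eval_frag_of [simp]: "f x \<in> carrier G \<Longrightarrow> frag_eval f (frag_of x) = f x"
  by (simp add: frag_eval_def keys_frag_of)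

lemma frag_eval_add:
  assumes "f \<in> Poly_Mapping.keys z \<rightarrow> carrier G" "f \<in> Poly_Mapping.keys w \<rightarrow> carrier G"
  shows "frag_eval f (z + w) = frag_eval f z \<otimes> frag_eval f w"
proof -
  let ?T = "Poly_Mapping.keys z \<union> Poly_Mapping.keys w"
  have f: "f \<in> ?T \<rightarrow> carrier G" using assms by auto
  have "frag_eval f (z + w) = (\<Otimes>x\<in>?T. f x [^] Poly_Mapping.lookup (z + w) x)"
    using f Poly_Mapping.keys_add[of z w] by (intro frag_eval_superset) auto
  also have "\<dots> = (\<Otimes>x\<in>?T. f x [^] Poly_Mapping.lookup z x \<otimes> f x [^] Poly_Mapping.lookup w x)"
    by (rule finprod_cong') (use f in \<open>auto simp: lookup_add Pi_iff intro!: int_pow_mult\<close>)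
  finally show ?thesis
    using f by (simp add: frag_eval_superset[of ?T] Pi_iff)
qed

lemma frag_eval_minus:
  assumes "f \<in> Poly_Mapping.keys z \<rightarrow> carrier G"
  shows "frag_eval f (- z) = inv (frag_eval f z)"
proof -
  have "frag_eval f (- z) \<otimes> frag_eval f z = \<one>"
    using frag_eval_add[of f "- z" z] assms by simp
  then show ?thesis using assms by (simp add: inv_equality)
qed

lemma frag_eval_diff:
  assumes "f \<in> Poly_Mapping.keys z \<rightarrow> carrier G" "f \<in> Poly_Mapping.keys w \<rightarrow> carrier G"
  shows "frag_eval f (z - w) = frag_eval f z \<otimes> inv (frag_eval f w)"
  using frag_eval_add[of f z "- w"] assms by (simp add: frag_eval_minus)

lemma frag_eval_cmul_frag_of:
  assumes "f x \<in> carrier G"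
  shows "frag_eval f (frag_cmul k (frag_of x)) = f x [^] k"
  using assms frag_eval_superset[of "{x}" "frag_cmul k (frag_of x)" f] by (simp add: subset_iff)

lemma frag_eval_sum:
  assumes "finite I" "\<And>i. i \<in> I \<Longrightarrow> f \<in> Poly_Mapping.keys (g i) \<rightarrow> carrier G"
  shows "frag_eval f (\<Sum>i\<in>I. g i) = (\<Otimes>i\<in>I. frag_eval f (g i))"
  using assms
proof (induction I rule: finite_induct)
  case (insert i I)
  have "f \<in> Poly_Mapping.keys (\<Sum>i\<in>I. g i) \<rightarrow> carrier G"
    using insert.prems keys_sum[of g I] by (auto simp: Pi_iff subset_iff) blast
  then show ?case using insert by (simp add: frag_eval_add)
qed simp

lemma frag_eval_cong:
  assumes "\<And>x. x \<in> Poly_Mapping.keys z \<Longrightarrow> f x = g x" "g \<in> Poly_Mapping.keys z \<rightarrow> carrier G"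
  shows "frag_eval f z = frag_eval g z"
  unfolding frag_eval_def by (rule finprod_cong') (use assms in auto)

lemma frag_eval_one: "(\<And>x. x \<in> Poly_Mapping.keys z \<Longrightarrow> f x = \<one>) \<Longrightarrow> frag_eval f z = \<one>"
  unfolding frag_eval_def by (rule finprod_one_eqI) simp

lemma frag_eval_mult:
  assumes "f \<in> Poly_Mapping.keys z \<rightarrow> carrier G" "g \<in> Poly_Mapping.keys z \<rightarrow> carrier G"
  shows "frag_eval (\<lambda>x. f x \<otimes> g x) z = frag_eval f z \<otimes> frag_eval g z"
proof -
  have "frag_eval (\<lambda>x. f x \<otimes> g x) z
      = (\<Otimes>x\<in>Poly_Mapping.keys z. f x [^] Poly_Mapping.lookup z x \<otimes> g x [^] Poly_Mapping.lookup z x)"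
    unfolding frag_eval_def
    by (rule finprod_cong') (use assms in \<open>auto simp: int_pow_distrib Pi_iff\<close>)
  then show ?thesis using assms by (simp add: frag_eval_def Pi_iff)
qed

lemma frag_eval_frag_extend:
  assumes "Poly_Mapping.keys z \<subseteq> S" "\<And>x. x \<in> S \<Longrightarrow> f \<in> Poly_Mapping.keys (g x) \<rightarrow> carrier G"
  shows "frag_eval f (frag_extend g z) = frag_eval (\<lambda>x. frag_eval f (g x)) z"
proof -
  have ext: "f \<in> Poly_Mapping.keys (frag_extend g w) \<rightarrow> carrier G"
    if "Poly_Mapping.keys w \<subseteq> S" for w
    using that assms(2) keys_frag_extend[of g w] by fastforce
  \<comment> \<open>The support condition is carried inside the induction, since the difference case
    otherwise provides no information on the supports of the two parts.\<close>
  have "Poly_Mapping.keys z \<subseteq> S \<and>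
    frag_eval f (frag_extend g z) = frag_eval (\<lambda>x. frag_eval f (g x)) z"
    using assms(1)
  proof (induction z rule: frag_induction)
    case (diff a b)
    then have "(\<lambda>x. frag_eval f (g x)) \<in> Poly_Mapping.keys c \<rightarrow> carrier G" if "c \<in> {a, b}" for c
      using that assms(2) by (blast intro: frag_eval_closed)
    with diff show ?case
      using ext by (simp add: frag_extend_diff frag_eval_diff keys_minus_subset)
  qed (use assms(2) in \<open>auto simp: keys_frag_of\<close>)
  then show ?thesis ..
qed

end

lemma (in group_hom) hom_finprod:
  assumes "comm_group G" "comm_group H" "f \<in> T \<rightarrow> carrier G"
  shows "h (finprod G f T) = finprod H (\<lambda>x. h (f x)) T"
proof -
  interpret G: comm_group G by fact
  interpret H: comm_group H by fact
  show ?thesis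
    using assms(3) by (induction T rule: infinite_finite_induct) (auto simp: Pi_iff)
qed

lemma hom_frag_eval:
  assumes "comm_group B" "comm_group B'" "h \<in> hom B B'" "f \<in> Poly_Mapping.keys z \<rightarrow> carrier B"
  shows "h (comm_group.frag_eval B f z) = comm_group.frag_eval B' (\<lambda>x. h (f x)) z"
proof -
  interpret B: comm_group B by fact
  interpret B': comm_group B' by fact
  interpret group_hom B B' h using assms(3) by unfold_locales
  have "h (B.frag_eval f z)
      = (\<Otimes>\<^bsub>B'\<^esub>x\<in>Poly_Mapping.keys z. h (f x [^]\<^bsub>B\<^esub> Poly_Mapping.lookup z x))"
    using assms(4) unfolding B.frag_eval_def by (intro hom_finprod assms) auto
  also have "\<dots> = B'.frag_eval (\<lambda>x. h (f x)) z"
    unfolding B'.frag_eval_def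
    by (rule B'.finprod_cong') (use assms(4) in \<open>auto simp: hom_int_pow Pi_iff\<close>)
  finally show ?thesis .
qed


section \<open>Homotopy equivalences of cochain complexes\<close>

lemma (in comm_monoid) mult_interchange:
  "\<lbrakk>a \<in> carrier G; b \<in> carrier G; c \<in> carrier G; d \<in> carrier G\<rbrakk>
    \<Longrightarrow> (a \<otimes> b) \<otimes> (c \<otimes> d) = (a \<otimes> c) \<otimes> (b \<otimes> d)"
  by (simp add: m_ac)

lemma comm_group_product_group:
  assumes "\<And>i. i \<in> I \<Longrightarrow> comm_group (H i)"
  shows "comm_group (product_group I H)"
proof (rule group.group_comm_groupI)
  show "group (product_group I H)"
    using assms by (simp add: comm_group_def)
  fix x y assume "x \<in> carrier (product_group I H)" "y \<in> carrier (product_group I H)"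
  then show "x \<otimes>\<^bsub>product_group I H\<^esub> y = y \<otimes>\<^bsub>product_group I H\<^esub> x"
    using comm_monoid.m_comm[OF comm_group.axioms(1)[OF assms]]
    by (auto simp: PiE_iff intro!: restrict_ext)
qed

text \<open>If \<open>f\<close> is surjective and its kernel is contracted by the operators \<open>h\<close>, then subtracting
  \<open>\<delta> h + h \<delta>\<close> from the identity gives an endomorphism that factors through \<open>f\<close>; the factor
  is the homotopy inverse.\<close>

lemma homotopy_equivalence_of_contraction:
  assumes C: "cochain_complex C" and D: "\<And>n. comm_group (grp D n)"
    and f: "\<And>n. f n \<in> hom (grp C n) (grp D n)"
    and f_diff: "\<And>n x. x \<in> carrier (grp C n) \<Longrightarrow> diff D n (f n x) = f (Suc n) (diff C n x)"
    and surj: "\<And>n. carrier (grp D n) \<subseteq> f n ` carrier (grp C n)"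
    and h: "\<And>n. h n \<in> hom (grp C (Suc n)) (grp C n)"
    and fh: "\<And>n x. x \<in> carrier (grp C (Suc n)) \<Longrightarrow> f n (h n x) = \<one>\<^bsub>grp D n\<^esub>"
    and ker_0: "\<And>x. \<lbrakk>x \<in> carrier (grp C 0); f 0 x = \<one>\<^bsub>grp D 0\<^esub>\<rbrakk> \<Longrightarrow> h 0 (diff C 0 x) = x"
    and ker_Suc: "\<And>n x. \<lbrakk>x \<in> carrier (grp C (Suc n)); f (Suc n) x = \<one>\<^bsub>grp D (Suc n)\<^esub>\<rbrakk>
      \<Longrightarrow> diff C n (h n x) \<otimes>\<^bsub>grp C (Suc n)\<^esub> h (Suc n) (diff C (Suc n) x) = x"
  shows "homotopy_equivalence C D f"
proof -
  have cgC: "comm_group (grp C n)" for n using C by (simp add: cochain_complex_def)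
  interpret C: comm_group "grp C n" for n by (rule cgC)
  interpret D: comm_group "grp D n" for n by (rule D)
  interpret f: group_hom "grp C n" "grp D n" "f n" for n using f by unfold_locales
  interpret h: group_hom "grp C (Suc n)" "grp C n" "h n" for n using h by unfold_locales
  interpret d: group_hom "grp C n" "grp C (Suc n)" "diff C n" for n
    using C by unfold_locales (simp add: cochain_complex_def)
  have dd: "diff C (Suc n) (diff C n x) = \<one>\<^bsub>grp C (Suc (Suc n))\<^esub>"
    if "x \<in> carrier (grp C n)" for n x
    using C that by (simp add: cochain_complex_def)
  \<comment> \<open>By surjectivity, identities in \<open>D\<close> can be checked on values of
    \<open>f\<close>. The complex axioms for \<open>D\<close> are derived from those of
    \<open>C\<close> in this way.\<close>
  have surjD: "\<exists>x\<in>carrier (grp C n). y = f n x" if "y \<in> carrier (grp D n)" for n y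
    using surj that by blast
  have d_hom: "diff D n \<in> hom (grp D n) (grp D (Suc n))" for n
  proof (rule homI)
    fix y assume "y \<in> carrier (grp D n)"
    then show "diff D n y \<in> carrier (grp D (Suc n))"
      using surjD[of y n] by (auto simp: f_diff)
  next
    fix y y' assume "y \<in> carrier (grp D n)" "y' \<in> carrier (grp D n)"
    then obtain x x' where x: "x \<in> carrier (grp C n)" "x' \<in> carrier (grp C n)"
      "y = f n x" "y' = f n x'" using surjD by meson
    then have "diff D n (y \<otimes>\<^bsub>grp D n\<^esub> y') = diff D n (f n (x \<otimes>\<^bsub>grp C n\<^esub> x'))" by simp
    also have "\<dots> = f (Suc n) (diff C n (x \<otimes>\<^bsub>grp C n\<^esub> x'))"
      using x by (intro f_diff C.m_closed)
    also have "\<dots> = diff D n y \<otimes>\<^bsub>grp D (Suc n)\<^esub> diff D n y'" using x by (simp add: f_diff)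
    finally show "diff D n (y \<otimes>\<^bsub>grp D n\<^esub> y') = diff D n y \<otimes>\<^bsub>grp D (Suc n)\<^esub> diff D n y'" .
  qed
  have "diff D (Suc n) (diff D n y) = \<one>\<^bsub>grp D (Suc (Suc n))\<^esub>"
    if "y \<in> carrier (grp D n)" for n y
    using surjD[OF that] by (auto simp: f_diff dd)
  then have complex_D: "cochain_complex D"
    using d_hom D by (simp add: cochain_complex_def)
  have map_f: "cochain_map C D f"
    using f f_diff by (simp add: cochain_map_def)
  \<comment> \<open>E is \<delta> h + h \<delta>; in degree 0 the first summand is absent because no
    group precedes.\<close>
  define E where "E n x = (case n of 0 \<Rightarrow> h 0 (diff C 0 x)
    | Suc m \<Rightarrow> diff C m (h m x) \<otimes>\<^bsub>grp C (Suc m)\<^esub> h (Suc m) (diff C (Suc m) x))" for n x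
  have E_closed: "E n x \<in> carrier (grp C n)" if "x \<in> carrier (grp C n)" for n x
    using that by (cases n) (auto simp: E_def)
  have E_mult: "E n (x \<otimes>\<^bsub>grp C n\<^esub> y) = E n x \<otimes>\<^bsub>grp C n\<^esub> E n y"
    if "x \<in> carrier (grp C n)" "y \<in> carrier (grp C n)" for n x y
    using that by (cases n) (simp_all add: E_def C.mult_interchange)
  interpret E: group_hom "grp C n" "grp C n" "E n" for n
    using E_closed E_mult by unfold_locales (auto simp: hom_def)
  have E_ker: "E n x = x" if "x \<in> carrier (grp C n)" "f n x = \<one>\<^bsub>grp D n\<^esub>" for n x
    using that ker_0 ker_Suc by (cases n) (auto simp: E_def)
  \<comment> \<open>Both summands die under \<open>f\<close>: the second by \<open>fh\<close>, the
    first because f \<delta> h = \<delta> f h.\<close>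
  have f_E: "f n (E n x) = \<one>\<^bsub>grp D n\<^esub>" if "x \<in> carrier (grp C n)" for n x
  proof (cases n)
    case (Suc m)
    then show ?thesis
      using that fh f_diff[of "h m x" m, symmetric] by (simp add: E_def hom_one[OF d_hom])
  qed (use that fh in \<open>simp add: E_def\<close>)
  \<comment> \<open>Both sides reduce to \<delta> h \<delta>, since \<delta> \<delta> is
    trivial.\<close>
  have E_diff: "diff C n (E n x) = E (Suc n) (diff C n x)" if "x \<in> carrier (grp C n)" for n x
    using that dd by (cases n) (auto simp: E_def)
  define p where "p n x = x \<otimes>\<^bsub>grp C n\<^esub> inv\<^bsub>grp C n\<^esub> (E n x)" for n x
  have p_closed: "p n x \<in> carrier (grp C n)" if "x \<in> carrier (grp C n)" for n x
    using that by (simp add: p_def)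
  have p_mult: "p n (x \<otimes>\<^bsub>grp C n\<^esub> y) = p n x \<otimes>\<^bsub>grp C n\<^esub> p n y"
    if "x \<in> carrier (grp C n)" "y \<in> carrier (grp C n)" for n x y
    using that by (simp add: p_def C.inv_mult C.mult_interchange)
  interpret p: group_hom "grp C n" "grp C n" "p n" for n
    using p_closed p_mult by unfold_locales (auto simp: hom_def)
  have f_p: "f n (p n x) = f n x" if "x \<in> carrier (grp C n)" for n x
    using that by (simp add: p_def f_E)
  have p_diff: "diff C n (p n x) = p (Suc n) (diff C n x)" if "x \<in> carrier (grp C n)" for n x
    using that by (simp add: p_def E_diff)
  \<comment> \<open>The quotient of x and y lies in the kernel of f, where E is the identity and p
    is therefore trivial. Hence p factors through f.\<close>
  have p_eq: "p n x = p n y" if "x \<in> carrier (grp C n)" "y \<in> carrier (grp C n)" "f n x = f n y"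
    for n x y
  proof -
    have "p n (x \<otimes>\<^bsub>grp C n\<^esub> inv\<^bsub>grp C n\<^esub> y) = \<one>\<^bsub>grp C n\<^esub>"
      using that E_ker[of "x \<otimes>\<^bsub>grp C n\<^esub> inv\<^bsub>grp C n\<^esub> y" n] by (simp add: p_def del: E.hom_mult)
    then have "p n x \<otimes>\<^bsub>grp C n\<^esub> inv\<^bsub>grp C n\<^esub> (p n y) = \<one>\<^bsub>grp C n\<^esub>"
      using that by simp
    then show ?thesis
      using that C.inv_equality[of n "p n x" "inv\<^bsub>grp C n\<^esub> (p n y)"] by simp
  qed
  \<comment> \<open>The chosen preimage need not depend on y homomorphically; \<open>p_eq\<close>
    makes the choice irrelevant, so that \<open>g_f\<close> determines g.\<close>
  define g where "g n y = p n (inv_into (carrier (grp C n)) (f n) y)" for n y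
  have g_f: "g n (f n x) = p n x" if "x \<in> carrier (grp C n)" for n x
  proof -
    have "f n x \<in> f n ` carrier (grp C n)" using that by blast
    then show ?thesis
      unfolding g_def using that by (intro p_eq) (simp_all add: f_inv_into_f inv_into_into)
  qed
  have map_g: "cochain_map D C g"
    unfolding cochain_map_def
  proof (intro conjI allI ballI)
    show "g n \<in> hom (grp D n) (grp C n)" for n
    proof (rule homI)
      fix y assume "y \<in> carrier (grp D n)"
      then show "g n y \<in> carrier (grp C n)" using surjD[of y n] by (auto simp: g_f)
    next
      fix y y' assume "y \<in> carrier (grp D n)" "y' \<in> carrier (grp D n)"
      then obtain x x' where x: "x \<in> carrier (grp C n)" "x' \<in> carrier (grp C n)"
        "y = f n x" "y' = f n x'" using surjD by meson
      then have "g n (y \<otimes>\<^bsub>grp D n\<^esub> y') = g n (f n (x \<otimes>\<^bsub>grp C n\<^esub> x'))" by simp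
      also have "\<dots> = g n y \<otimes>\<^bsub>grp C n\<^esub> g n y'" using x by (simp only: g_f C.m_closed p_mult)
      finally show "g n (y \<otimes>\<^bsub>grp D n\<^esub> y') = g n y \<otimes>\<^bsub>grp C n\<^esub> g n y'" .
    qed
    show "diff C n (g n y) = g (Suc n) (diff D n y)" if "y \<in> carrier (grp D n)" for n y
      using surjD[OF that] by (auto simp: g_f p_diff f_diff)
  qed
  \<comment> \<open>The homotopy relation concerns g f - id = p - id = -E, so the homotopy has to be
    the pointwise inverse of \<open>h\<close>.\<close>
  have "p n x \<otimes>\<^bsub>grp C n\<^esub> inv\<^bsub>grp C n\<^esub> x = inv\<^bsub>grp C n\<^esub> (E n x)"
    if "x \<in> carrier (grp C n)" for n x
  proof -
    have "p n x = inv\<^bsub>grp C n\<^esub> (E n x) \<otimes>\<^bsub>grp C n\<^esub> x"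
      using that unfolding p_def by (intro C.m_comm) simp_all
    then show ?thesis using that by (simp add: C.m_assoc)
  qed
  then have "cochain_homotopic C C (\<lambda>n. g n \<circ> f n) (\<lambda>n. id)"
    unfolding cochain_homotopic_def
    by (intro exI[of _ "\<lambda>n x. inv\<^bsub>grp C n\<^esub> (h n x)"])
      (simp add: g_f E_def hom_def C.inv_mult)
  \<comment> \<open>Since E lands in the kernel of f, f p = f. The composite on \<open>D\<close> is
    thus the identity, and the trivial homotopy suffices there.\<close>
  moreover have "f n (g n y) = y" if "y \<in> carrier (grp D n)" for n y
    using surjD[OF that] by (auto simp: g_f f_p)
  then have "cochain_homotopic D D (\<lambda>n. f n \<circ> g n) (\<lambda>n. id)"
    unfolding cochain_homotopic_def using d_hom
    by (intro exI[of _ "\<lambda>n x. \<one>\<^bsub>grp D n\<^esub>"]) (auto simp: hom_def hom_one[OF d_hom])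
  ultimately show ?thesis
    using C complex_D map_f map_g by (auto simp: homotopy_equivalence_def)
qed


section \<open>Homotopy equivalences induce isomorphisms in cohomology\<close>

lemma coboundaries_subgroup:
  assumes "cochain_complex C"
  shows "subgroup (coboundaries C n) (grp C n)"
proof -
  interpret C: comm_group "grp C m" for m using assms by (simp add: cochain_complex_def)
  interpret d: group_hom "grp C m" "grp C (Suc m)" "diff C m" for m
    using assms by unfold_locales (simp add: cochain_complex_def)
  show ?thesis
    using C.triv_subgroup d.img_is_subgroup unfolding coboundaries_def by (cases n) simp_all
qed

lemma cocycles_subgroup:
  assumes "cochain_complex C"
  shows "subgroup (cocycles C n) (grp C n)"
proof -
  interpret C: comm_group "grp C m" for m using assms by (simp add: cochain_complex_def)
  interpret d: group_hom "grp C m" "grp C (Suc m)" "diff C m" for m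
    using assms by unfold_locales (simp add: cochain_complex_def)
  show ?thesis unfolding cocycles_def by (rule d.subgroup_kernel)
qed

lemma cochain_map_cocycles:
  assumes "cochain_complex C" "cochain_complex D" "cochain_map C D f" "z \<in> cocycles C n"
  shows "f n z \<in> cocycles D n"
proof -
  have "group (grp C (Suc n))" "group (grp D (Suc n))" "f (Suc n) \<in> hom (grp C (Suc n)) (grp D (Suc n))"
    using assms by (auto simp: cochain_complex_def comm_group_def cochain_map_def)
  then have "f (Suc n) \<one>\<^bsub>grp C (Suc n)\<^esub> = \<one>\<^bsub>grp D (Suc n)\<^esub>" by (simp add: hom_one)
  then show ?thesis
    using assms(3,4) by (auto simp: cochain_map_def cocycles_def kernel_def hom_def)
qed

lemma cochain_map_coboundaries:
  assumes "cochain_complex C" "cochain_complex D" "cochain_map C D f" "b \<in> coboundaries C n"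
  shows "f n b \<in> coboundaries D n"
proof (cases n)
  case 0
  have "group (grp C 0)" "group (grp D 0)" "f 0 \<in> hom (grp C 0) (grp D 0)"
    using assms by (auto simp: cochain_complex_def comm_group_def cochain_map_def)
  then show ?thesis using 0 assms(4) by (simp add: coboundaries_def hom_one)
next
  case (Suc m)
  with assms(4) obtain x where x: "x \<in> carrier (grp C m)" "b = diff C m x"
    by (auto simp: coboundaries_def)
  then have "f m x \<in> carrier (grp D m)" "f n b = diff D m (f m x)"
    using assms(3) Suc by (auto simp: cochain_map_def hom_def)
  then show ?thesis using Suc by (simp add: coboundaries_def)
qed

text \<open>On a cocycle the summand h (\<delta> z) is trivial, so the difference is \<delta> (h z),
  or neutral in degree 0.\<close>

lemma cochain_homotopic_id_cocycles:
  assumes "cochain_complex C" "cochain_homotopic C C k (\<lambda>n. id)" "z \<in> cocycles C n"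
  shows "k n z \<otimes>\<^bsub>grp C n\<^esub> inv\<^bsub>grp C n\<^esub> z \<in> coboundaries C n"
proof -
  interpret C: comm_group "grp C m" for m using assms by (simp add: cochain_complex_def)
  obtain h where h: "\<And>n. h n \<in> hom (grp C (Suc n)) (grp C n)"
    and h0: "\<And>x. x \<in> carrier (grp C 0) \<Longrightarrow>
        k 0 x \<otimes>\<^bsub>grp C 0\<^esub> inv\<^bsub>grp C 0\<^esub> x = h 0 (diff C 0 x)"
    and hS: "\<And>n x. x \<in> carrier (grp C (Suc n)) \<Longrightarrow>
        k (Suc n) x \<otimes>\<^bsub>grp C (Suc n)\<^esub> inv\<^bsub>grp C (Suc n)\<^esub> x
        = diff C n (h n x) \<otimes>\<^bsub>grp C (Suc n)\<^esub> h (Suc n) (diff C (Suc n) x)"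
    using assms(2) unfolding cochain_homotopic_def id_apply by blast
  interpret h: group_hom "grp C (Suc m)" "grp C m" "h m" for m using h by unfold_locales
  interpret d: group_hom "grp C m" "grp C (Suc m)" "diff C m" for m
    using assms by unfold_locales (simp add: cochain_complex_def)
  have z: "z \<in> carrier (grp C n)" "diff C n z = \<one>\<^bsub>grp C (Suc n)\<^esub>"
    using assms(3) by (auto simp: cocycles_def kernel_def)
  show ?thesis
  proof (cases n)
    case 0
    then show ?thesis using z h0[of z] by (simp add: coboundaries_def)
  next
    case (Suc m)
    then have "k n z \<otimes>\<^bsub>grp C n\<^esub> inv\<^bsub>grp C n\<^esub> z = diff C m (h m z)"
      using z hS[of z m] by simp
    then show ?thesis using z Suc by (simp add: coboundaries_def)
  qed
qed

lemma (in group) rcoset_eq_iff: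
  assumes "subgroup H G" "x \<in> carrier G" "y \<in> carrier G"
  shows "H #> x = H #> y \<longleftrightarrow> x \<otimes> inv y \<in> H"
  using assms rcos_self repr_independence subgroup.rcos_module[OF assms(1) group_axioms]
  by metis

lemma carrier_cohomology:
  "carrier (cohomology C n) = (\<lambda>z. coboundaries C n #>\<^bsub>grp C n\<^esub> z) ` cocycles C n"
  by (auto simp: cohomology_def FactGroup_def RCOSETS_def r_coset_def)

lemma mult_cohomology:
  assumes "cochain_complex C" "z \<in> cocycles C n" "w \<in> cocycles C n"
  shows "(coboundaries C n #>\<^bsub>grp C n\<^esub> z) \<otimes>\<^bsub>cohomology C n\<^esub> (coboundaries C n #>\<^bsub>grp C n\<^esub> w)
    = coboundaries C n #>\<^bsub>grp C n\<^esub> (z \<otimes>\<^bsub>grp C n\<^esub> w)"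
proof -
  interpret C: comm_group "grp C n" using assms by (simp add: cochain_complex_def)
  interpret N: normal "coboundaries C n" "grp C n"
    using coboundaries_subgroup[OF assms(1)] by (rule C.subgroup_imp_normal)
  have "z \<in> carrier (grp C n)" "w \<in> carrier (grp C n)"
    using assms by (auto simp: cocycles_def kernel_def)
  then show ?thesis
    using N.rcos_sum by (simp add: cohomology_def set_mult_def)
qed

text \<open>Injectivity: if f u is a coboundary then so is g (f u), which differs from u by a
  coboundary. Surjectivity: the class of w is the image of the class of g w.\<close>

theorem homotopy_equivalence_cohomology_iso:
  assumes "homotopy_equivalence C D f"
  shows "cohomology_map D f n \<in> iso (cohomology C n) (cohomology D n)"
proof -
  from assms obtain g where C: "cochain_complex C" and D: "cochain_complex D"
    and f: "cochain_map C D f" and g: "cochain_map D C g"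
    and gf: "cochain_homotopic C C (\<lambda>n. g n \<circ> f n) (\<lambda>n. id)"
    and fg: "cochain_homotopic D D (\<lambda>n. f n \<circ> g n) (\<lambda>n. id)"
    by (auto simp: homotopy_equivalence_def)
  interpret C: comm_group "grp C n" using C by (simp add: cochain_complex_def)
  interpret D: comm_group "grp D n" using D by (simp add: cochain_complex_def)
  interpret f: group_hom "grp C n" "grp D n" "f n"
    using f by unfold_locales (simp add: cochain_map_def)
  note BC = coboundaries_subgroup[OF C, of n] and BD = coboundaries_subgroup[OF D, of n]
  note ZC = cocycles_subgroup[OF C, of n] and ZD = cocycles_subgroup[OF D, of n]
  note f_coset = cohomology_map_coset[OF C D f]
  have "cohomology_map D f n \<in> hom (cohomology C n) (cohomology D n)"
  proof (rule homI)
    fix X assume "X \<in> carrier (cohomology C n)"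
    then show "cohomology_map D f n X \<in> carrier (cohomology D n)"
      using cochain_map_cocycles[OF C D f] by (auto simp: carrier_cohomology f_coset)
  next
    fix X Y assume "X \<in> carrier (cohomology C n)" "Y \<in> carrier (cohomology C n)"
    then obtain z w where z: "z \<in> cocycles C n" "X = coboundaries C n #>\<^bsub>grp C n\<^esub> z"
      and w: "w \<in> cocycles C n" "Y = coboundaries C n #>\<^bsub>grp C n\<^esub> w"
      by (auto simp: carrier_cohomology)
    then show "cohomology_map D f n (X \<otimes>\<^bsub>cohomology C n\<^esub> Y)
        = cohomology_map D f n X \<otimes>\<^bsub>cohomology D n\<^esub> cohomology_map D f n Y"
      using cochain_map_cocycles[OF C D f] subgroup.m_closed[OF ZC]
      by (simp add: mult_cohomology C D f_coset subgroup.mem_carrier[OF ZC])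
  qed
  moreover have "inj_on (cohomology_map D f n) (carrier (cohomology C n))"
  proof (rule inj_onI)
    fix X Y assume "X \<in> carrier (cohomology C n)" "Y \<in> carrier (cohomology C n)"
      and eq: "cohomology_map D f n X = cohomology_map D f n Y"
    then obtain z w where z: "z \<in> cocycles C n" "X = coboundaries C n #>\<^bsub>grp C n\<^esub> z"
      and w: "w \<in> cocycles C n" "Y = coboundaries C n #>\<^bsub>grp C n\<^esub> w"
      by (auto simp: carrier_cohomology)
    then have zw: "z \<in> carrier (grp C n)" "w \<in> carrier (grp C n)"
      using ZC by (auto dest: subgroup.mem_carrier)
    let ?u = "z \<otimes>\<^bsub>grp C n\<^esub> inv\<^bsub>grp C n\<^esub> w"
    have u: "?u \<in> cocycles C n"
      using ZC z w by (simp add: subgroup.m_closed subgroup.m_inv_closed)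
    have "f n ?u \<in> coboundaries D n"
      using eq z w zw by (simp add: f_coset D.rcoset_eq_iff[OF BD])
    then have gfu: "g n (f n ?u) \<in> coboundaries C n"
      by (rule cochain_map_coboundaries[OF D C g])
    have "g n (f n ?u) \<otimes>\<^bsub>grp C n\<^esub> inv\<^bsub>grp C n\<^esub> ?u \<in> coboundaries C n"
      using cochain_homotopic_id_cocycles[OF C gf u] by simp
    then have "coboundaries C n #>\<^bsub>grp C n\<^esub> g n (f n ?u) = coboundaries C n #>\<^bsub>grp C n\<^esub> ?u"
      using C.rcoset_eq_iff[OF BC] subgroup.mem_carrier[OF BC gfu] zw by simp
    then have "?u \<in> coboundaries C n"
      using C.rcos_self[of ?u "coboundaries C n"] BC gfu zw
      by (simp add: subgroup.rcos_const[OF BC])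
    then show "X = Y" using z w zw by (simp add: C.rcoset_eq_iff[OF BC])
  qed
  moreover have "carrier (cohomology D n) \<subseteq> cohomology_map D f n ` carrier (cohomology C n)"
  proof
    fix Y assume "Y \<in> carrier (cohomology D n)"
    then obtain w where w: "w \<in> cocycles D n" "Y = coboundaries D n #>\<^bsub>grp D n\<^esub> w"
      by (auto simp: carrier_cohomology)
    have gw: "g n w \<in> cocycles C n"
      by (rule cochain_map_cocycles[OF D C g w(1)])
    have "f n (g n w) \<otimes>\<^bsub>grp D n\<^esub> inv\<^bsub>grp D n\<^esub> w \<in> coboundaries D n"
      using cochain_homotopic_id_cocycles[OF D fg w(1)] by simp
    then have "coboundaries D n #>\<^bsub>grp D n\<^esub> f n (g n w) = Y"
      using w gw D.rcoset_eq_iff[OF BD]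
      by (simp add: subgroup.mem_carrier[OF ZC] subgroup.mem_carrier[OF ZD])
    then have "Y = cohomology_map D f n (coboundaries C n #>\<^bsub>grp C n\<^esub> g n w)"
      using gw by (simp add: f_coset)
    then show "Y \<in> cohomology_map D f n ` carrier (cohomology C n)"
      using gw by (auto simp: carrier_cohomology)
  qed
  ultimately show ?thesis
    by (auto simp: iso_def bij_betw_def hom_def)
qed


section \<open>Contracting Cech cochains that vanish on inclusion chains\<close>

text \<open>These are the simplices at which the value of a cochain can be restricted to
  \<open>W\<close>.\<close>

definition star_simplices :: "'a set set \<Rightarrow> nat \<Rightarrow> 'a set \<Rightarrow> 'a set list set" where
  "star_simplices \<U> n W = {t \<in> cech_simplices \<U> n. W \<subseteq> \<Inter>(set t)}"

text \<open>A carrier condition on an operator from n-simplices to m-chains: it guarantees that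
  every cochain value occurring at \<open>T s\<close> restricts to the intersection of
  \<open>s\<close>.\<close>

definition carried ::
    "'a set set \<Rightarrow> nat \<Rightarrow> nat \<Rightarrow> ('a set list \<Rightarrow> 'a set list \<Rightarrow>\<^sub>0 int) \<Rightarrow> bool" where
  "carried \<U> n m T \<longleftrightarrow>
     (\<forall>s \<in> cech_simplices \<U> n. Poly_Mapping.keys (T s) \<subseteq> star_simplices \<U> m (\<Inter>(set s)))"

lemma carriedD:
  "\<lbrakk>carried \<U> n m T; s \<in> cech_simplices \<U> n\<rbrakk>
    \<Longrightarrow> Poly_Mapping.keys (T s) \<subseteq> star_simplices \<U> m (\<Inter>(set s))"
  by (simp add: carried_def)

lemma omit_star_simplices:
  assumes s: "s \<in> cech_simplices \<U> (Suc n)" and i: "i < length s"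
  shows "omit i s \<in> star_simplices \<U> n (\<Inter>(set s))"
proof -
  have "\<Inter>(set s) \<subseteq> \<Inter>(set (omit i s))" by (rule Inter_anti_mono[OF set_omit_subset])
  moreover have "set (omit i s) \<subseteq> \<U>" "length (omit i s) = Suc n" "\<Inter>(set s) \<noteq> {}"
    using s i set_omit_subset[of i s] by (auto simp: cech_simplices_def)
  ultimately show ?thesis by (auto simp only: star_simplices_def cech_simplices_def)
qed

lemma carried_list_boundary: "carried \<U> (Suc n) n list_boundary"
  unfolding carried_def
proof (intro ballI subsetI)
  fix s t assume s: "s \<in> cech_simplices \<U> (Suc n)" and "t \<in> Poly_Mapping.keys (list_boundary s)"
  then obtain i where i: "i < length s" "t = omit i s"
    using keys_list_boundary[of s] by auto
  then show "t \<in> star_simplices \<U> n (\<Inter>(set s))"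
    using omit_star_simplices[OF s] by simp
qed

text \<open>Carrier conditions compose because inclusion of the intersections is transitive.\<close>

lemma carried_frag_extend:
  assumes "carried \<U> n m T" "carried \<U> m k T'"
  shows "carried \<U> n k (\<lambda>s. frag_extend T' (T s))"
  unfolding carried_def
proof (intro ballI subsetI)
  fix s u assume s: "s \<in> cech_simplices \<U> n" and "u \<in> Poly_Mapping.keys (frag_extend T' (T s))"
  then obtain t where t: "t \<in> Poly_Mapping.keys (T s)" "u \<in> Poly_Mapping.keys (T' t)"
    using keys_frag_extend[of T' "T s"] by blast
  then have "t \<in> star_simplices \<U> m (\<Inter>(set s))" using carriedD[OF assms(1) s] by blast
  moreover from this have "u \<in> star_simplices \<U> k (\<Inter>(set t))"
    using t carriedD[OF assms(2), of t] by (auto simp: star_simplices_def)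
  ultimately show "u \<in> star_simplices \<U> k (\<Inter>(set s))"
    unfolding star_simplices_def by blast
qed

lemma (in intersection_closed) carried_chain_homotopy: "carried \<U> n (Suc n) chain_homotopy"
  unfolding carried_def
proof (intro ballI subsetI)
  fix s t assume s: "s \<in> cech_simplices \<U> n" and t: "t \<in> Poly_Mapping.keys (chain_homotopy s)"
  have "s \<in> lists {U \<in> \<U>. \<Inter>(set s) \<subseteq> U}" "\<Inter>(set s) \<noteq> {}" "length s = Suc n"
    using s by (auto simp: cech_simplices_def)
  then have "t \<in> lists {U \<in> \<U>. \<Inter>(set s) \<subseteq> U}" "length t = Suc (Suc n)"
    using keys_chain_homotopy[of "\<Inter>(set s)" s] t by auto
  moreover from this have "\<Inter>(set s) \<subseteq> \<Inter>(set t)" by blast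
  ultimately show "t \<in> star_simplices \<U> (Suc n) (\<Inter>(set s))"
    using s by (auto simp: star_simplices_def cech_simplices_def)
qed

lemma (in intersection_closed) carried_chain_projection: "carried \<U> n n chain_projection"
  unfolding carried_def
proof (intro ballI subsetI)
  fix s t assume s: "s \<in> cech_simplices \<U> n" and t: "t \<in> Poly_Mapping.keys (chain_projection s)"
  have "s \<in> lists {U \<in> \<U>. \<Inter>(set s) \<subseteq> U}" "\<Inter>(set s) \<noteq> {}" "length s = Suc n"
    using s by (auto simp: cech_simplices_def)
  then have "t \<in> lists {U \<in> \<U>. \<Inter>(set s) \<subseteq> U}" "length t = Suc n"
    using keys_chain_projection[of "\<Inter>(set s)" s] t by auto
  moreover from this have "\<Inter>(set s) \<subseteq> \<Inter>(set t)" by blast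
  ultimately show "t \<in> star_simplices \<U> n (\<Inter>(set s))"
    using s by (auto simp: star_simplices_def cech_simplices_def)
qed

text \<open>The covering is itself treated as a poset under inclusion. An arrow from U to V acts by
  restriction from V to U, hence the swapped arguments of \<open>res\<close>. Closure under
  intersections puts \<open>\<Inter>(set s)\<close> among the objects for every simplex
  \<open>s\<close>.\<close>

locale cech_coefficients =
  intersection_closed \<U> +
  contravariant_functor \<U> "{(U, V). U \<in> \<U> \<and> V \<in> \<U> \<and> U \<subseteq> V}" F "\<lambda>U V. res V U"
  for \<U> :: "'a set set" and F :: "'a set \<Rightarrow> 'h monoid"
    and res :: "'a set \<Rightarrow> 'a set \<Rightarrow> 'h \<Rightarrow> 'h"
begin

abbreviation K :: "('a set list \<Rightarrow> 'h) cochains" where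
  "K \<equiv> cech_complex \<U> F res"

lemma grp_K: "grp K n = product_group (cech_simplices \<U> n) (\<lambda>s. F (\<Inter>(set s)))"
  by (simp add: cech_complex_def)

lemma Inter_simplex: "s \<in> cech_simplices \<U> n \<Longrightarrow> \<Inter>(set s) \<in> \<U>"
  by (rule Inter_closed) (auto simp: cech_simplices_def)

lemma comm_group_simplex: "s \<in> cech_simplices \<U> n \<Longrightarrow> comm_group (F (\<Inter>(set s)))"
  by (simp add: Inter_simplex group)

lemma comm_group_grp_K: "comm_group (grp K n)"
  unfolding grp_K by (rule comm_group_product_group) (rule comm_group_simplex)

lemma carrier_K_mem:
  "\<lbrakk>c \<in> carrier (grp K n); s \<in> cech_simplices \<U> n\<rbrakk> \<Longrightarrow> c s \<in> carrier (F (\<Inter>(set s)))"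
  by (auto simp: grp_K PiE_mem)

definition restricted :: "('a set list \<Rightarrow> 'h) \<Rightarrow> 'a set \<Rightarrow> 'a set list \<Rightarrow> 'h" where
  "restricted c W t = res (\<Inter>(set t)) W (c t)"

lemma res_hom:
  assumes "t \<in> star_simplices \<U> m W" "W \<in> \<U>"
  shows "res (\<Inter>(set t)) W \<in> hom (F (\<Inter>(set t))) (F W)"
  using assms hom[of W "\<Inter>(set t)"] Inter_simplex[of t m] by (simp add: star_simplices_def)

lemma restricted_closed:
  assumes "c \<in> carrier (grp K m)" "W \<in> \<U>"
  shows "restricted c W \<in> star_simplices \<U> m W \<rightarrow> carrier (F W)"
proof
  fix t assume t: "t \<in> star_simplices \<U> m W"
  then have "c t \<in> carrier (F (\<Inter>(set t)))"
    using carrier_K_mem[OF assms(1)] by (simp add: star_simplices_def)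
  then show "restricted c W t \<in> carrier (F W)"
    using res_hom[OF t assms(2)] by (auto simp: restricted_def hom_def)
qed

text \<open>The transpose of \<open>T\<close> with coefficients: values at the lists in
  \<open>T s\<close> are first restricted to the intersection of \<open>s\<close>, then combined.
  The index \<open>n\<close> is the degree of the result.\<close>

definition pull ::
    "nat \<Rightarrow> ('a set list \<Rightarrow> 'a set list \<Rightarrow>\<^sub>0 int) \<Rightarrow> ('a set list \<Rightarrow> 'h) \<Rightarrow> 'a set list \<Rightarrow> 'h"
  where "pull n T c = (\<lambda>s\<in>cech_simplices \<U> n.
    comm_group.frag_eval (F (\<Inter>(set s))) (restricted c (\<Inter>(set s))) (T s))"

lemma restricted_keys:
  assumes "carried \<U> n m T" "s \<in> cech_simplices \<U> n" "c \<in> carrier (grp K m)"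
  shows "restricted c (\<Inter>(set s)) \<in> Poly_Mapping.keys (T s) \<rightarrow> carrier (F (\<Inter>(set s)))"
  using restricted_closed[OF assms(3) Inter_simplex[OF assms(2)]] carriedD[OF assms(1,2)] by blast

lemma pull_hom:
  assumes T: "carried \<U> n m T"
  shows "pull n T \<in> hom (grp K m) (grp K n)"
proof (rule homI)
  fix c assume c: "c \<in> carrier (grp K m)"
  have "pull n T c s \<in> carrier (F (\<Inter>(set s)))" if s: "s \<in> cech_simplices \<U> n" for s
    using comm_group.frag_eval_closed[OF comm_group_simplex[OF s] restricted_keys[OF T s c]] s
    by (simp add: pull_def)
  then show "pull n T c \<in> carrier (grp K n)"
    by (auto simp: grp_K pull_def)
next
  fix c d assume c: "c \<in> carrier (grp K m)" and d: "d \<in> carrier (grp K m)"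
  let ?cd = "c \<otimes>\<^bsub>grp K m\<^esub> d"
  have "pull n T ?cd s = pull n T c s \<otimes>\<^bsub>F (\<Inter>(set s))\<^esub> pull n T d s"
    if s: "s \<in> cech_simplices \<U> n" for s
  proof -
    let ?W = "\<Inter>(set s)"
    interpret W: comm_group "F ?W" using s by (rule comm_group_simplex)
    note rc = restricted_keys[OF T s c] and rd = restricted_keys[OF T s d]
    have "restricted ?cd ?W t = restricted c ?W t \<otimes>\<^bsub>F ?W\<^esub> restricted d ?W t"
      if "t \<in> Poly_Mapping.keys (T s)" for t
    proof -
      have t: "t \<in> star_simplices \<U> m ?W" using carriedD[OF T s] that by blast
      then have "t \<in> cech_simplices \<U> m" by (simp add: star_simplices_def)
      then show ?thesis
        using res_hom[OF t Inter_simplex[OF s]] carrier_K_mem[OF c] carrier_K_mem[OF d]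
        by (auto simp: restricted_def grp_K hom_def)
    qed
    then have "W.frag_eval (restricted ?cd ?W) (T s)
        = W.frag_eval (\<lambda>t. restricted c ?W t \<otimes>\<^bsub>F ?W\<^esub> restricted d ?W t) (T s)"
      using rc rd by (intro W.frag_eval_cong) auto
    then show ?thesis using s rc rd by (simp add: pull_def W.frag_eval_mult)
  qed
  then show "pull n T ?cd = pull n T c \<otimes>\<^bsub>grp K n\<^esub> pull n T d"
    unfolding grp_K by (auto simp: pull_def)
qed

lemma pull_closed:
  "\<lbrakk>carried \<U> n m T; c \<in> carrier (grp K m)\<rbrakk> \<Longrightarrow> pull n T c \<in> carrier (grp K n)"
  using pull_hom by (auto simp: hom_def)

text \<open>Transposition reverses composition. Restriction is a homomorphism, so it passes inside
  the inner evaluation, and there two successive restrictions merge into one.\<close>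

lemma pull_pull:
  assumes T: "carried \<U> n m T" and T': "carried \<U> m k T'" and c: "c \<in> carrier (grp K k)"
  shows "pull n T (pull m T' c) = pull n (\<lambda>s. frag_extend T' (T s)) c"
proof -
  have "comm_group.frag_eval (F W) (restricted (pull m T' c) W) (T s)
      = comm_group.frag_eval (F W) (restricted c W) (frag_extend T' (T s))"
    if s: "s \<in> cech_simplices \<U> n" and W: "W = \<Inter>(set s)" for s W
  proof -
    interpret W: comm_group "F W" using s unfolding W by (rule comm_group_simplex)
    note WU = Inter_simplex[OF s, folded W]
    have *: "restricted c W \<in> Poly_Mapping.keys (T' t) \<rightarrow> carrier (F W)"
        "restricted (pull m T' c) W t = W.frag_eval (restricted c W) (T' t)"
      if t: "t \<in> star_simplices \<U> m W" for t
    proof -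
      let ?V = "\<Inter>(set t)"
      have tm: "t \<in> cech_simplices \<U> m" "W \<subseteq> ?V" using t by (auto simp: star_simplices_def)
      have sub: "star_simplices \<U> k ?V \<subseteq> star_simplices \<U> k W"
        using tm(2) unfolding star_simplices_def by blast
      then show r: "restricted c W \<in> Poly_Mapping.keys (T' t) \<rightarrow> carrier (F W)"
        using restricted_closed[OF c WU] carriedD[OF T' tm(1)] by blast
      have "restricted (pull m T' c) W t = W.frag_eval (\<lambda>u. res ?V W (restricted c ?V u)) (T' t)"
        using tm(1) hom_frag_eval[OF comm_group_simplex[OF tm(1)] W.comm_group_axioms
            res_hom[OF t WU] restricted_keys[OF T' tm(1) c]]
        by (subst restricted_def) (simp add: pull_def)
      also have "\<dots> = W.frag_eval (restricted c W) (T' t)"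
      proof (rule W.frag_eval_cong[OF _ r])
        fix u assume "u \<in> Poly_Mapping.keys (T' t)"
        then have "u \<in> cech_simplices \<U> k" "?V \<subseteq> \<Inter>(set u)"
          using carriedD[OF T' tm(1)] by (auto simp: star_simplices_def)
        then show "res ?V W (restricted c ?V u) = restricted c W u"
          using comp[of W ?V "\<Inter>(set u)" "c u"] tm WU Inter_simplex carrier_K_mem[OF c]
          by (simp add: restricted_def)
      qed
      finally show "restricted (pull m T' c) W t = W.frag_eval (restricted c W) (T' t)" .
    qed
    have keys: "Poly_Mapping.keys (T s) \<subseteq> star_simplices \<U> m W"
      using carriedD[OF T s] by (simp add: W)
    have "W.frag_eval (restricted c W) (frag_extend T' (T s))
        = W.frag_eval (\<lambda>t. W.frag_eval (restricted c W) (T' t)) (T s)"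
      using keys *(1) by (rule W.frag_eval_frag_extend)
    also have "\<dots> = W.frag_eval (restricted (pull m T' c) W) (T s)"
      using keys * by (intro W.frag_eval_cong) (auto intro!: W.frag_eval_closed)
    finally show ?thesis ..
  qed
  then show ?thesis by (auto simp: pull_def)
qed

text \<open>Identities for the Cech differential thereby become identities of formal chains.\<close>

lemma diff_K:
  assumes c: "c \<in> carrier (grp K n)"
  shows "diff K n c = pull (Suc n) list_boundary c"
proof -
  have "(\<Otimes>\<^bsub>F W\<^esub>i\<in>{0..Suc n}. res (\<Inter>(set (omit i s))) W (c (omit i s)) [^]\<^bsub>F W\<^esub> ((-1)^i :: int))
      = comm_group.frag_eval (F W) (restricted c W) (list_boundary s)"
    if s: "s \<in> cech_simplices \<U> (Suc n)" and W: "W = \<Inter>(set s)" for s W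
  proof -
    interpret W: comm_group "F W" using s unfolding W by (rule comm_group_simplex)
    have len: "{..<length s} = {0..Suc n}"
      using s by (auto simp: cech_simplices_def)
    have r: "restricted c W (omit i s) \<in> carrier (F W)" if "i \<in> {0..Suc n}" for i
    proof -
      have "omit i s \<in> star_simplices \<U> n W"
        using omit_star_simplices[OF s, of i] that len W by blast
      then show ?thesis using restricted_closed[OF c] Inter_simplex[OF s] W by blast
    qed
    have "W.frag_eval (restricted c W) (list_boundary s)
        = (\<Otimes>\<^bsub>F W\<^esub>i\<in>{0..Suc n}. W.frag_eval (restricted c W) (frag_cmul ((-1)^i) (frag_of (omit i s))))"
      unfolding list_boundary_def len
      by (rule W.frag_eval_sum) (use r in \<open>auto simp: keys_frag_of\<close>)
    also have "\<dots> = (\<Otimes>\<^bsub>F W\<^esub>i\<in>{0..Suc n}. restricted c W (omit i s) [^]\<^bsub>F W\<^esub> ((-1)^i :: int))"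
      by (rule W.finprod_cong') (use r in \<open>auto simp: W.frag_eval_cmul_frag_of\<close>)
    finally show ?thesis by (simp add: restricted_def)
  qed
  then show ?thesis
    by (auto simp: cech_complex_def pull_def)
qed

lemma pull_zero: "pull n (\<lambda>s. 0) c = \<one>\<^bsub>grp K n\<^esub>"
  by (auto simp: pull_def grp_K comm_group.frag_eval_0[OF comm_group_simplex])

lemma cochain_complex_K: "cochain_complex K"
  unfolding cochain_complex_def
proof (intro conjI allI ballI)
  show "comm_group (grp K n)" for n by (rule comm_group_grp_K)
  note bd = carried_list_boundary[of \<U>]
  show "diff K n \<in> hom (grp K n) (grp K (Suc n))" for n
  proof -
    interpret comm_group "grp K n" by (rule comm_group_grp_K)
    show ?thesis using pull_hom[OF bd, of n] by (simp add: hom_def diff_K Pi_iff)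
  qed
  show "diff K (Suc n) (diff K n c) = \<one>\<^bsub>grp K (Suc (Suc n))\<^esub>" if "c \<in> carrier (grp K n)" for n c
    using that by (simp add: diff_K pull_closed[OF bd] pull_pull[OF bd bd] pull_zero)
qed

abbreviation contraction :: "nat \<Rightarrow> ('a set list \<Rightarrow> 'h) \<Rightarrow> 'a set list \<Rightarrow> 'h" where
  "contraction n \<equiv> pull n chain_homotopy"

lemma contraction_chain:
  assumes "s \<in> cech_simplices \<U> n" "sorted_wrt (\<subseteq>) s"
  shows "contraction n c s = \<one>\<^bsub>F (\<Inter>(set s))\<^esub>"
  using assms by (simp add: pull_def comm_group.frag_eval_0[OF comm_group_simplex])

text \<open>The two summands are the transposes of H \<partial> and \<partial> H, so together they
  transpose id - p. The contribution of p vanishes because \<open>c\<close> is trivial on increasing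
  lists.\<close>

lemma contraction_Suc:
  assumes c: "c \<in> carrier (grp K (Suc n))"
    and chains: "\<And>s. \<lbrakk>s \<in> cech_simplices \<U> (Suc n); sorted_wrt (\<subseteq>) s\<rbrakk> \<Longrightarrow> c s = \<one>\<^bsub>F (\<Inter>(set s))\<^esub>"
  shows "diff K n (contraction n c) \<otimes>\<^bsub>grp K (Suc n)\<^esub> contraction (Suc n) (diff K (Suc n) c) = c"
    (is "?L = c")
proof
  fix s
  note H = carried_chain_homotopy and bd = carried_list_boundary[of \<U>]
  show "?L s = c s"
  proof (cases "s \<in> cech_simplices \<U> (Suc n)")
    case True
    let ?W = "\<Inter>(set s)"
    interpret W: comm_group "F ?W" using True by (rule comm_group_simplex)
    have r: "restricted c ?W \<in> Poly_Mapping.keys (T s) \<rightarrow> carrier (F ?W)"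
      if "carried \<U> (Suc n) (Suc n) T" for T
      using that True c by (rule restricted_keys)
    have rs: "restricted c ?W s = c s"
      using True c by (simp add: restricted_def ident Inter_simplex carrier_K_mem)
    \<comment> \<open>Every list in p s is increasing, so \<open>c\<close> is neutral there, and
      restriction to \<open>?W\<close> preserves the neutral element.\<close>
    have one: "restricted c ?W t = \<one>\<^bsub>F ?W\<^esub>" if "t \<in> Poly_Mapping.keys (chain_projection s)" for t
    proof -
      have t: "t \<in> star_simplices \<U> (Suc n) ?W"
        using carriedD[OF carried_chain_projection True] that by blast
      have "s \<in> lists {U \<in> \<U>. ?W \<subseteq> U}" "?W \<noteq> {}"
        using True by (auto simp: cech_simplices_def)
      then have "sorted_wrt (\<subseteq>) t" using that keys_chain_projection[of ?W s] by blast
      then have "c t = \<one>\<^bsub>F (\<Inter>(set t))\<^esub>" using t chains by (simp add: star_simplices_def)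
      moreover have "comm_group (F (\<Inter>(set t)))"
        using t comm_group_simplex by (auto simp: star_simplices_def)
      ultimately show ?thesis
        using hom_one[OF res_hom[OF t Inter_simplex[OF True]]] W.is_group
        by (simp add: restricted_def comm_group_def)
    qed
    have "?L s = W.frag_eval (restricted c ?W) (frag_extend chain_homotopy (list_boundary s))
        \<otimes>\<^bsub>F ?W\<^esub> W.frag_eval (restricted c ?W) (boundary (chain_homotopy s))"
    proof -
      have "diff K n (contraction n c)
            = pull (Suc n) (\<lambda>s. frag_extend chain_homotopy (list_boundary s)) c"
          "contraction (Suc n) (diff K (Suc n) c) = pull (Suc n) (\<lambda>s. boundary (chain_homotopy s)) c"
        using c by (simp_all add: diff_K pull_closed[OF H] pull_pull[OF bd H] pull_pull[OF H bd])
      then show ?thesis using True by (simp add: grp_K) (simp add: pull_def)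
    qed
    also have "\<dots> = W.frag_eval (restricted c ?W)
        (frag_extend chain_homotopy (list_boundary s) + boundary (chain_homotopy s))"
      by (rule W.frag_eval_add[symmetric])
        (rule r[OF carried_frag_extend[OF bd H]] r[OF carried_frag_extend[OF H bd]])+
    also have "\<dots> = W.frag_eval (restricted c ?W) (frag_of s - chain_projection s)"
      by (simp add: chain_projection_def)
    also have "\<dots> = c s"
    proof -
      have "restricted c ?W \<in> Poly_Mapping.keys (frag_of s) \<rightarrow> carrier (F ?W)"
        using rs True c by (simp add: keys_frag_of carrier_K_mem)
      then show ?thesis
        using rs True c one
        by (simp add: W.frag_eval_diff r[OF carried_chain_projection] W.frag_eval_one carrier_K_mem)
    qed
    finally show ?thesis .
  next
    case False
    then show ?thesis using c by (auto simp: grp_K PiE_def extensional_def)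
  qed
qed

text \<open>One-element lists are increasing, so in degree 0 both sides are neutral at every
  simplex.\<close>

lemma contraction_0:
  assumes c: "c \<in> carrier (grp K 0)"
    and chains: "\<And>s. \<lbrakk>s \<in> cech_simplices \<U> 0; sorted_wrt (\<subseteq>) s\<rbrakk> \<Longrightarrow> c s = \<one>\<^bsub>F (\<Inter>(set s))\<^esub>"
  shows "contraction 0 (diff K 0 c) = c"
proof
  fix s
  show "contraction 0 (diff K 0 c) s = c s"
  proof (cases "s \<in> cech_simplices \<U> 0")
    case True
    then obtain U where "s = [U]" by (auto simp: cech_simplices_def length_Suc_conv)
    then have "sorted_wrt (\<subseteq>) s" by simp
    then show ?thesis using True chains contraction_chain by simp
  next
    case False
    then show ?thesis using c by (auto simp: pull_def grp_K PiE_def extensional_def)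
  qed
qed

end


section \<open>The canonical covering of a poset with conditional products\<close>

locale poset_coefficients = contravariant_functor A r G \<rho>
  for A :: "'a set" and r :: "'a rel" and G :: "'a \<Rightarrow> 'g monoid" and \<rho> :: "'a \<Rightarrow> 'a \<Rightarrow> 'g \<Rightarrow> 'g" +
  assumes po: "partial_order_on A r" and products: "conditional_products A r"
begin

abbreviation U :: "'a \<Rightarrow> 'a set" where "U \<equiv> basic_open r"
abbreviation \<U> :: "'a set set" where "\<U> \<equiv> canonical_cover A r"
abbreviation S :: "'a set \<Rightarrow> ('a \<Rightarrow> 'g) monoid" where "S \<equiv> induced_sheaf r G \<rho>"
abbreviation Cech :: "('a set list \<Rightarrow> 'a \<Rightarrow> 'g) cochains" where
  "Cech \<equiv> cech_complex \<U> S sheaf_restriction"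
abbreviation Nerve :: "('a list \<Rightarrow> 'g) cochains" where "Nerve \<equiv> nerve_complex A r G \<rho>"

lemma r_subset: "r \<subseteq> A \<times> A"
  and r_refl: "\<alpha> \<in> A \<Longrightarrow> (\<alpha>, \<alpha>) \<in> r"
  and r_trans: "\<lbrakk>(\<alpha>, \<beta>) \<in> r; (\<beta>, \<gamma>) \<in> r\<rbrakk> \<Longrightarrow> (\<alpha>, \<gamma>) \<in> r"
  and r_antisym: "\<lbrakk>(\<alpha>, \<beta>) \<in> r; (\<beta>, \<alpha>) \<in> r\<rbrakk> \<Longrightarrow> \<alpha> = \<beta>"
  using po by (auto simp: partial_order_on_def preorder_on_def refl_on_def dest: transD antisymD)

lemma basic_open_subset: "U \<alpha> \<subseteq> A"
  using r_subset by (auto simp: basic_open_def)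

lemma mem_basic_open: "\<alpha> \<in> A \<Longrightarrow> \<alpha> \<in> U \<alpha>"
  by (simp add: basic_open_def r_refl)

lemma basic_open_subset_iff: "\<alpha> \<in> A \<Longrightarrow> U \<alpha> \<subseteq> U \<beta> \<longleftrightarrow> (\<alpha>, \<beta>) \<in> r"
  by (auto simp: basic_open_def intro: r_refl r_trans)

text \<open>A point of the intersection is the common \<omega> that makes the product \<pi> exist,
  and by its universal property the basic open set of \<pi> is the intersection.\<close>

lemma Int_basic_open:
  assumes "V \<in> \<U>" "W \<in> \<U>" "V \<inter> W \<noteq> {}"
  shows "V \<inter> W \<in> \<U>"
proof -
  from assms obtain \<alpha> \<beta> \<omega> where ab: "\<alpha> \<in> A" "\<beta> \<in> A" "V = U \<alpha>" "W = U \<beta>"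
    and "(\<omega>, \<alpha>) \<in> r" "(\<omega>, \<beta>) \<in> r"
    by (auto simp: canonical_cover_def basic_open_def)
  moreover from this have "\<omega> \<in> A" using r_subset by auto
  ultimately obtain \<pi> where \<pi>: "is_product A r \<alpha> \<beta> \<pi>"
    using products unfolding conditional_products_def by blast
  then have "U \<alpha> \<inter> U \<beta> = U \<pi>"
    using r_subset by (auto simp: basic_open_def is_product_def intro: r_trans)
  then show ?thesis using \<pi> ab by (auto simp: canonical_cover_def is_product_def)
qed

lemma induced_sheaf_closed: "\<lbrakk>x \<in> carrier (S W); \<omega> \<in> W\<rbrakk> \<Longrightarrow> x \<omega> \<in> carrier (G \<omega>)"
  by (auto simp: induced_sheaf_def PiE_mem)

lemma induced_sheaf_ext: "x \<in> carrier (S W) \<Longrightarrow> x \<in> extensional W"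
  by (simp add: induced_sheaf_def PiE_def)

lemma sheaf_restriction_hom:
  assumes "W \<subseteq> V"
  shows "sheaf_restriction V W \<in> hom (S V) (S W)"
  using assms
  by (auto simp: hom_def induced_sheaf_def sheaf_restriction_def subset_iff PiE_iff fun_eq_iff)

sublocale cech: cech_coefficients \<U> S sheaf_restriction
proof (intro cech_coefficients.intro intersection_closed.intro contravariant_functor.intro)
  show "V \<inter> W \<in> \<U>" if "V \<in> \<U>" "W \<in> \<U>" "V \<inter> W \<noteq> {}" for V W
    using that by (rule Int_basic_open)
  show "comm_group (S W)" if "W \<in> \<U>" for W
    using that basic_open_subset by (auto simp: canonical_cover_def intro!: comm_group_induced_sheaf)
  show "sheaf_restriction V W \<in> hom (S V) (S W)"
    if "(W, V) \<in> {(U, V). U \<in> \<U> \<and> V \<in> \<U> \<and> U \<subseteq> V}" for V W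
    using that by (simp add: sheaf_restriction_hom)
  show "sheaf_restriction W W x = x" if "x \<in> carrier (S W)" for W x
    using induced_sheaf_ext[OF that] by (simp add: sheaf_restriction_def extensional_restrict)
  show "sheaf_restriction V W (sheaf_restriction V' V x) = sheaf_restriction V' W x"
    if "(W, V) \<in> {(U, V). U \<in> \<U> \<and> V \<in> \<U> \<and> U \<subseteq> V}" for W V V' and x :: "'a \<Rightarrow> 'g"
    using that by (auto simp: sheaf_restriction_def restrict_def fun_eq_iff)
qed

text \<open>Transitivity passes from consecutive entries to all pairs, a form that survives the
  omission of an entry.\<close>

lemma nerve_simplices_iff:
  "s \<in> nerve_simplices A r n \<longleftrightarrow> length s = Suc n \<and> set s \<subseteq> A \<and> sorted_wrt (\<lambda>\<alpha> \<beta>. (\<alpha>, \<beta>) \<in> r) s"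
proof -
  have "transp (\<lambda>\<alpha> \<beta>. (\<alpha>, \<beta>) \<in> r)" by (auto intro: transpI r_trans)
  then show ?thesis
    by (auto simp: nerve_simplices_def sorted_wrt_iff_nth_Suc_transp)
qed

lemma sorted_map_basic_open:
  assumes "set s \<subseteq> A"
  shows "sorted_wrt (\<subseteq>) (map U s) \<longleftrightarrow> sorted_wrt (\<lambda>\<alpha> \<beta>. (\<alpha>, \<beta>) \<in> r) s"
  unfolding sorted_wrt_map using assms
  by (intro iffI; elim sorted_wrt_mono_rel[rotated]) (meson basic_open_subset_iff subsetD)+

lemma nerve_head: "s \<in> nerve_simplices A r n \<Longrightarrow> s ! 0 \<in> A"
  by (auto simp: nerve_simplices_def)

text \<open>The head is the least entry. Hence the Cech coefficients at such a simplex are the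
  sections over a single basic open set, which evaluation at the head identifies with
  \<open>G (s ! 0)\<close>.\<close>

lemma Inter_map_basic_open:
  assumes "s \<in> nerve_simplices A r n"
  shows "\<Inter>(set (map U s)) = U (s ! 0)"
proof -
  obtain \<alpha> t where "s = \<alpha> # t" using assms by (cases s) (auto simp: nerve_simplices_def)
  then show ?thesis
    using assms by (auto simp: nerve_simplices_iff basic_open_def intro: r_trans)
qed

lemma map_basic_open_simplex:
  assumes "s \<in> nerve_simplices A r n"
  shows "map U s \<in> cech_simplices \<U> n" "sorted_wrt (\<subseteq>) (map U s)"
  using assms Inter_map_basic_open[OF assms] mem_basic_open[OF nerve_head[OF assms]]
  by (auto simp: cech_simplices_def nerve_simplices_iff canonical_cover_def sorted_map_basic_open)

text \<open>\<open>basic_open\<close> reflects the order, so increasing Cech simplices come from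
  nerve simplices.\<close>

lemma chain_simplexE:
  assumes "t \<in> cech_simplices \<U> n" "sorted_wrt (\<subseteq>) t"
  obtains s where "s \<in> nerve_simplices A r n" "t = map U s"
proof -
  have "t \<in> lists (U ` A)" using assms(1) by (auto simp: cech_simplices_def canonical_cover_def)
  then obtain s where s: "set s \<subseteq> A" "t = map U s" by (auto simp: lists_image)
  then show thesis
    using that[of s] assms by (simp add: nerve_simplices_iff cech_simplices_def sorted_map_basic_open)
qed

lemma omit_nerve_simplex:
  assumes "s \<in> nerve_simplices A r (Suc n)" "i \<le> Suc n"
  shows "omit i s \<in> nerve_simplices A r n"
  using assms set_omit_subset[of i s] by (auto simp: nerve_simplices_iff sorted_wrt_omit)

section \<open>The map \<open>j_star\<close>: cochain map, surjectivity and kernel\<close>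

lemma grp_Nerve: "grp Nerve n = product_group (nerve_simplices A r n) (\<lambda>s. G (s ! 0))"
  by (simp add: nerve_complex_def)

lemma comm_group_grp_Nerve: "comm_group (grp Nerve n)"
  unfolding grp_Nerve by (rule comm_group_product_group) (simp add: group nerve_head)

lemma cochain_at_chain:
  assumes "c \<in> carrier (grp Cech n)" "s \<in> nerve_simplices A r n"
  shows "c (map U s) \<in> carrier (S (U (s ! 0)))"
  using cech.carrier_K_mem[OF assms(1) map_basic_open_simplex(1)[OF assms(2)]]
    Inter_map_basic_open[OF assms(2)] by simp

lemma j_star_hom: "j_star A r n \<in> hom (grp Cech n) (grp Nerve n)"
proof (rule homI)
  fix c assume "c \<in> carrier (grp Cech n)"
  then have "c (map U s) (s ! 0) \<in> carrier (G (s ! 0))" if "s \<in> nerve_simplices A r n" for s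
    using induced_sheaf_closed[OF cochain_at_chain] mem_basic_open[OF nerve_head] that by blast
  then show "j_star A r n c \<in> carrier (grp Nerve n)"
    by (auto simp: grp_Nerve j_star_def)
next
  fix c d assume "c \<in> carrier (grp Cech n)" "d \<in> carrier (grp Cech n)"
  have "(c \<otimes>\<^bsub>grp Cech n\<^esub> d) (map U s) (s ! 0) = c (map U s) (s ! 0) \<otimes>\<^bsub>G (s ! 0)\<^esub> d (map U s) (s ! 0)"
    if "s \<in> nerve_simplices A r n" for s
    using map_basic_open_simplex(1)[OF that] Inter_map_basic_open[OF that]
      mem_basic_open[OF nerve_head[OF that]]
    by (simp add: cech.grp_K induced_sheaf_def)
  then show "j_star A r n (c \<otimes>\<^bsub>grp Cech n\<^esub> d) = j_star A r n c \<otimes>\<^bsub>grp Nerve n\<^esub> j_star A r n d"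
    by (auto simp: grp_Nerve j_star_def)
qed

text \<open>Evaluation at the first vertex is a homomorphism, so it can be applied to each term of
  the Cech differential. Only the face that drops the first vertex changes the point of evaluation,
  which produces the \<rho> in the nerve differential.\<close>

lemma j_star_diff:
  assumes c: "c \<in> carrier (grp Cech n)"
  shows "diff Nerve n (j_star A r n c) = j_star A r (Suc n) (diff Cech n c)"
proof -
  have "\<rho> (s ! 0) (s ! 1) (j_star A r n c (omit 0 s)) \<otimes>\<^bsub>G (s ! 0)\<^esub>
        (\<Otimes>\<^bsub>G (s ! 0)\<^esub> i \<in> {1..Suc n}. j_star A r n c (omit i s) [^]\<^bsub>G (s ! 0)\<^esub> ((-1)^i :: int))
      = diff Cech n c (map U s) (s ! 0)"
    if s: "s \<in> nerve_simplices A r (Suc n)" for s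
  proof -
    let ?a = "s ! 0" and ?b = "s ! 1"
    let ?e = "\<lambda>x. x ?a"
    have aA: "?a \<in> A" using s by (rule nerve_head)
    interpret Ga: comm_group "G ?a" using aA by (rule group)
    interpret SU: comm_group "S (U ?a)"
      using basic_open_subset by (rule comm_group_induced_sheaf)
    interpret e: group_hom "S (U ?a)" "G ?a" ?e
      using eval_iso[OF po aA] by unfold_locales (simp add: iso_def)
    have omit: "omit i s \<in> nerve_simplices A r n" if "i \<le> Suc n" for i
      using s that by (rule omit_nerve_simplex)
    have sub: "U ?a \<subseteq> U (omit i s ! 0)" if "i \<le> Suc n" for i
      using Inter_map_basic_open[OF s] Inter_map_basic_open[OF omit[OF that]]
        Inter_anti_mono[OF set_omit_subset[of i "map U s"]] by (simp add: map_omit)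
    have rc: "sheaf_restriction (U (omit i s ! 0)) (U ?a) (c (map U (omit i s))) \<in> carrier (S (U ?a))"
      if "i \<le> Suc n" for i
      using sheaf_restriction_hom[OF sub[OF that]] cochain_at_chain[OF c omit[OF that]]
      by (auto simp: hom_def)
    have ca: "c (map U (omit i s)) ?a \<in> carrier (G ?a)" if "i \<le> Suc n" for i
      using induced_sheaf_closed[OF cochain_at_chain[OF c omit[OF that]]]
        sub[OF that] mem_basic_open[OF aA] by blast
    have "diff Cech n c (map U s) ?a = (\<Otimes>\<^bsub>S (U ?a)\<^esub> i \<in> {0..Suc n}.
        sheaf_restriction (U (omit i s ! 0)) (U ?a) (c (map U (omit i s))) [^]\<^bsub>S (U ?a)\<^esub> ((-1)^i :: int)) ?a"
    proof -
      have "diff Cech n c (map U s) = (\<Otimes>\<^bsub>S (U ?a)\<^esub> i \<in> {0..Suc n}.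
        sheaf_restriction (\<Inter>(set (omit i (map U s)))) (U ?a) (c (omit i (map U s))) [^]\<^bsub>S (U ?a)\<^esub> ((-1)^i :: int))"
        using map_basic_open_simplex(1)[OF s] Inter_map_basic_open[OF s]
        by (simp add: cech_complex_def)
      also have "\<dots> = (\<Otimes>\<^bsub>S (U ?a)\<^esub> i \<in> {0..Suc n}.
        sheaf_restriction (U (omit i s ! 0)) (U ?a) (c (map U (omit i s))) [^]\<^bsub>S (U ?a)\<^esub> ((-1)^i :: int))"
        by (rule SU.finprod_cong')
          (use rc Inter_map_basic_open[OF omit] in \<open>auto simp flip: map_omit simp del: set_map\<close>)
      finally show ?thesis by simp
    qed
    also have "\<dots> = (\<Otimes>\<^bsub>G ?a\<^esub> i \<in> {0..Suc n}.
        (sheaf_restriction (U (omit i s ! 0)) (U ?a) (c (map U (omit i s))) [^]\<^bsub>S (U ?a)\<^esub> ((-1)^i :: int)) ?a)"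
      by (rule e.hom_finprod[OF SU.comm_group_axioms Ga.comm_group_axioms]) (use rc in auto)
    also have "\<dots> = (\<Otimes>\<^bsub>G ?a\<^esub> i \<in> {0..Suc n}. c (map U (omit i s)) ?a [^]\<^bsub>G ?a\<^esub> ((-1)^i :: int))"
      by (rule Ga.finprod_cong')
        (use rc ca e.hom_int_pow mem_basic_open[OF aA] in \<open>auto simp: sheaf_restriction_def\<close>)
    also have "{0..Suc n} = insert 0 {1..Suc n}" by auto
    also have "(\<Otimes>\<^bsub>G ?a\<^esub> i \<in> insert 0 {1..Suc n}. c (map U (omit i s)) ?a [^]\<^bsub>G ?a\<^esub> ((-1)^i :: int))
      = c (map U (omit 0 s)) ?a \<otimes>\<^bsub>G ?a\<^esub>
        (\<Otimes>\<^bsub>G ?a\<^esub> i \<in> {1..Suc n}. c (map U (omit i s)) ?a [^]\<^bsub>G ?a\<^esub> ((-1)^i :: int))"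
      using ca by (subst Ga.finprod_insert) auto
    \<comment> \<open>The family lives on the open set of \<open>?b\<close> but is evaluated at
      \<open>?a\<close>; compatibility along the arrow from \<open>?a\<close> to \<open>?b\<close>
      expresses this through its value at \<open>?b\<close>.\<close>
    also have "c (map U (omit 0 s)) ?a = \<rho> ?a ?b (j_star A r n c (omit 0 s))"
    proof -
      have b: "omit 0 s ! 0 = ?b" using s by (simp add: omit_def nerve_simplices_def)
      have bA: "?b \<in> A" using nerve_head[OF omit[of 0]] b by simp
      have ab: "(?a, ?b) \<in> r" using sub[of 0] b basic_open_subset_iff[OF aA] by simp
      have "c (map U (omit 0 s)) \<in> carrier (S (U ?b))"
        using cochain_at_chain[OF c omit[of 0]] b by simp
      then have "\<rho> ?a ?b (c (map U (omit 0 s)) ?b) = c (map U (omit 0 s)) ?a"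
        using ab mem_basic_open[OF bA] by (auto simp: induced_sheaf_def basic_open_def)
      then show ?thesis using omit[of 0] b by (simp add: j_star_def)
    qed
    also have "(\<Otimes>\<^bsub>G ?a\<^esub> i \<in> {1..Suc n}. c (map U (omit i s)) ?a [^]\<^bsub>G ?a\<^esub> ((-1)^i :: int))
      = (\<Otimes>\<^bsub>G ?a\<^esub> i \<in> {1..Suc n}. j_star A r n c (omit i s) [^]\<^bsub>G ?a\<^esub> ((-1)^i :: int))"
    proof (rule Ga.finprod_cong')
      \<comment> \<open>For i at least 1 the head survives the omission, so both sides evaluate at
        the same point.\<close>
      have eq: "c (map U (omit i s)) ?a = j_star A r n c (omit i s)" if i: "i \<in> {1..Suc n}" for i
      proof -
        obtain k where "i = Suc k" using i by (cases i) auto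
        moreover obtain x t where "s = x # t"
          using s by (cases s) (auto simp: nerve_simplices_def)
        ultimately have "omit i s ! 0 = ?a" by simp
        then show ?thesis using omit i by (simp add: j_star_def)
      qed
      then show "c (map U (omit i s)) ?a [^]\<^bsub>G ?a\<^esub> ((-1)^i :: int)
          = j_star A r n c (omit i s) [^]\<^bsub>G ?a\<^esub> ((-1)^i :: int)" if "i \<in> {1..Suc n}" for i
        using that by simp
      show "(\<lambda>i. j_star A r n c (omit i s) [^]\<^bsub>G ?a\<^esub> ((-1)^i :: int)) \<in> {1..Suc n} \<rightarrow> carrier (G ?a)"
        using ca by (auto simp flip: eq)
    qed simp
    finally show ?thesis ..
  qed
  then show ?thesis
    by (auto simp: nerve_complex_def j_star_def)
qed

lemma j_star_surj: "carrier (grp Nerve n) \<subseteq> j_star A r n ` carrier (grp Cech n)"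
proof
  fix d assume d: "d \<in> carrier (grp Nerve n)"
  \<comment> \<open>On an increasing list the value of \<open>d\<close> at the head is spread over
    the whole open set by \<rho>. Elsewhere \<open>j_star\<close> sees nothing, so the neutral
    section will do. The inverse \<open>inv_into A U\<close> recovers vertices, as antisymmetry
    makes \<open>U\<close> injective.\<close>
  define c where "c = (\<lambda>t\<in>cech_simplices \<U> n. if sorted_wrt (\<subseteq>) t
      then (\<lambda>\<omega>\<in>\<Inter>(set t). \<rho> \<omega> (inv_into A U (t ! 0)) (d (map (inv_into A U) t)))
      else \<one>\<^bsub>S (\<Inter>(set t))\<^esub>)"
  have inj: "inj_on U A"
    by (intro inj_onI r_antisym) (simp_all flip: basic_open_subset_iff)
  have c_chain: "c (map U s) = (\<lambda>\<omega>\<in>U (s ! 0). \<rho> \<omega> (s ! 0) (d s))"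
    if s: "s \<in> nerve_simplices A r n" for s
  proof -
    have "set s \<subseteq> A" "s \<noteq> []" using s by (auto simp: nerve_simplices_def)
    then have "map (inv_into A U) (map U s) = s" "inv_into A U (map U s ! 0) = s ! 0"
      using inj by (auto simp: map_idI nth_mem subset_iff inv_into_f_f)
    then show ?thesis
      using map_basic_open_simplex[OF s] Inter_map_basic_open[OF s] by (simp add: c_def)
  qed
  have dG: "d s \<in> carrier (G (s ! 0))" if "s \<in> nerve_simplices A r n" for s
    using d that by (auto simp: grp_Nerve PiE_mem)
  have "c t \<in> carrier (S (\<Inter>(set t)))" if t: "t \<in> cech_simplices \<U> n" for t
  proof (cases "sorted_wrt (\<subseteq>) t")
    case True
    with t obtain s where s: "s \<in> nerve_simplices A r n" "t = map U s" by (rule chain_simplexE)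
    have "(\<lambda>\<omega>\<in>U (s ! 0). \<rho> \<omega> (s ! 0) (d s)) \<in> carrier (S (U (s ! 0)))"
      using dG[OF s(1)] comp hom[unfolded hom_def]
      by (auto simp: induced_sheaf_def basic_open_def PiE_def Pi_def)
    then show ?thesis
      using c_chain[OF s(1)] Inter_map_basic_open[OF s(1)] s(2) by simp
  next
    case False
    interpret comm_group "S (\<Inter>(set t))" using t by (rule cech.comm_group_simplex)
    show ?thesis using False t by (simp add: c_def)
  qed
  then have "c \<in> carrier (grp Cech n)" by (auto simp: cech.grp_K c_def)
  moreover have "j_star A r n c = d"
  proof
    fix s
    show "j_star A r n c s = d s"
    proof (cases "s \<in> nerve_simplices A r n")
      case True
      then show ?thesis
        using nerve_head[OF True] mem_basic_open ident dG by (simp add: j_star_def c_chain)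
    next
      case False
      then show ?thesis using d by (auto simp: j_star_def grp_Nerve PiE_def extensional_def)
    qed
  qed
  ultimately show "d \<in> j_star A r n ` carrier (grp Cech n)" by blast
qed

text \<open>Evaluation at \<alpha> is injective on sections over its basic open set, so triviality
  at the head forces the whole section to be trivial. This puts kernel elements in the form that the
  contraction lemmas require.\<close>

lemma j_star_eq_one:
  assumes c: "c \<in> carrier (grp Cech n)" and j: "j_star A r n c = \<one>\<^bsub>grp Nerve n\<^esub>"
    and t: "t \<in> cech_simplices \<U> n" "sorted_wrt (\<subseteq>) t"
  shows "c t = \<one>\<^bsub>S (\<Inter>(set t))\<^esub>"
proof -
  obtain s where s: "s \<in> nerve_simplices A r n" "t = map U s"
    using t by (rule chain_simplexE)
  let ?a = "s ! 0"
  have aA: "?a \<in> A" using s(1) by (rule nerve_head)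
  interpret SU: comm_group "S (U ?a)" using basic_open_subset by (rule comm_group_induced_sheaf)
  have e: "(\<lambda>x. x ?a) \<in> iso (S (U ?a)) (G ?a)" using po aA by (rule eval_iso)
  then have "(\<one>\<^bsub>S (U ?a)\<^esub>) ?a = \<one>\<^bsub>G ?a\<^esub>"
    using hom_one[of "\<lambda>x. x ?a" "S (U ?a)" "G ?a"] SU.is_group group[OF aA]
    by (simp add: iso_def comm_group_def)
  moreover have "c (map U s) ?a = \<one>\<^bsub>G ?a\<^esub>"
    using fun_cong[OF j, of s] s(1) by (simp add: j_star_def grp_Nerve)
  moreover have "inj_on (\<lambda>x. x ?a) (carrier (S (U ?a)))"
    using e by (simp add: iso_def bij_betw_def)
  ultimately have "c (map U s) = \<one>\<^bsub>S (U ?a)\<^esub>"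
    using cochain_at_chain[OF c s(1)] SU.one_closed by (simp add: inj_on_def)
  then show ?thesis using s Inter_map_basic_open[OF s(1)] by simp
qed

text \<open>\<open>j_star\<close> only reads values at increasing lists, where the recursion for H
  starts from zero.\<close>

lemma j_star_contraction:
  "j_star A r n (cech.contraction n c) = \<one>\<^bsub>grp Nerve n\<^esub>"
proof -
  have "cech.contraction n c (map U s) (s ! 0) = \<one>\<^bsub>G (s ! 0)\<^esub>" if s: "s \<in> nerve_simplices A r n" for s
    using cech.contraction_chain[OF map_basic_open_simplex[OF s]] Inter_map_basic_open[OF s]
      mem_basic_open[OF nerve_head[OF s]]
    by (simp add: induced_sheaf_def)
  then show ?thesis by (auto simp: j_star_def grp_Nerve)
qed

theorem homotopy_equivalence_j_star: "homotopy_equivalence Cech Nerve (j_star A r)"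
proof (rule homotopy_equivalence_of_contraction)
  show "cochain_complex Cech" by (rule cech.cochain_complex_K)
  show "comm_group (grp Nerve n)" for n by (rule comm_group_grp_Nerve)
  show "j_star A r n \<in> hom (grp Cech n) (grp Nerve n)" for n by (rule j_star_hom)
  show "diff Nerve n (j_star A r n c) = j_star A r (Suc n) (diff Cech n c)"
    if "c \<in> carrier (grp Cech n)" for n c
    using that by (rule j_star_diff)
  show "carrier (grp Nerve n) \<subseteq> j_star A r n ` carrier (grp Cech n)" for n by (rule j_star_surj)
  show "cech.contraction n \<in> hom (grp Cech (Suc n)) (grp Cech n)" for n
    by (rule cech.pull_hom[OF cech.carried_chain_homotopy])
  show "j_star A r n (cech.contraction n c) = \<one>\<^bsub>grp Nerve n\<^esub>" for n c
    by (rule j_star_contraction)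
  show "cech.contraction 0 (diff Cech 0 c) = c"
    if "c \<in> carrier (grp Cech 0)" "j_star A r 0 c = \<one>\<^bsub>grp Nerve 0\<^esub>" for c
    using cech.contraction_0[OF that(1) j_star_eq_one[OF that]] by blast
  show "diff Cech n (cech.contraction n c) \<otimes>\<^bsub>grp Cech (Suc n)\<^esub>
      cech.contraction (Suc n) (diff Cech (Suc n) c) = c"
    if "c \<in> carrier (grp Cech (Suc n))" "j_star A r (Suc n) c = \<one>\<^bsub>grp Nerve (Suc n)\<^esub>" for n c
    using cech.contraction_Suc[OF that(1) j_star_eq_one[OF that]] by blast
qed

end

theorem corollary6p32:
  fixes A :: "'a set" and r :: "'a rel"
    and G :: "'a \<Rightarrow> 'g monoid" and \<rho> :: "'a \<Rightarrow> 'a \<Rightarrow> 'g \<Rightarrow> 'g"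
  assumes "partial_order_on A r"
    and "conditional_products A r"
    and "contravariant_functor A r G \<rho>"
  shows "let K = cech_complex (canonical_cover A r) (induced_sheaf r G \<rho>) sheaf_restriction;
             N = nerve_complex A r G \<rho>
         in homotopy_equivalence K N (j_star A r) \<and>
            (\<forall>n. cohomology_map N (j_star A r) n \<in> iso (cohomology K n) (cohomology N n))"
proof -
  interpret poset_coefficients A r G \<rho>
    using assms by (simp add: poset_coefficients_def poset_coefficients_axioms_def)
  show ?thesis
    using homotopy_equivalence_j_star
    by (simp add: Let_def homotopy_equivalence_cohomology_iso)
qed

end
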